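(* Let $\ell$ be a positive integer, let $x$ be a positive rational number that is not an integer, and let $k$ be a positive integer such that $kx\in\mathbb Z$. Define $$g_{\ell,x}(\tau)=q^{-\frac\ell2x^2}\left(\partial\widehat A_\ell(x\tau;\tau)-2\pi i\ell x\,\widehat A_\ell(x\tau;\tau)\right).$$ Then $g_{\ell,x}=\partial\widehat A_\ell(-x)\vert_2\begin{pmatrix}0&-1\\1&0\end{pmatrix}$. As a consequence, for any $\begin{pmatrix}a&b\\c&d\end{pmatrix}\in\Gamma_1(k)$ we have $$g_{\ell,x}\left(k\,\frac{a\tau+b}{c\tau+d}\right)=(c\tau+d)^2e^{-\pi i\ell abkx^2}\cdot(-1)^{\ell((a-1)x+kbx)}\,g_{\ell,x}(k\tau).$$
   Context: $\mathbb H$ is the upper half-plane, $\tau\in\mathbb H$, $q=e^{2\pi i\tau}$, $q^r=e^{2\pi ir\tau}$. $\operatorname{sgn}(0)=0$, and $E(z)=2\int_0^ze^{-\pi u^2}du$ for real $z$. $\Gamma_1(k)$ is the group of matrices $\begin{pmatrix}a&b\\c&d\end{pmatrix}\in\mathrm{SL}_2(\mathbb Z)$ with $c\equiv0$, $a\equiv d\equiv1\pmod k$. For $u\in\mathbb C\setminus(\mathbb Z\tau+\mathbb Z)$ and integer $\ell\ge1$, $$A_\ell(u;\tau)=e^{\pi i\ell u}\sum_{n\in\mathbb Z}\frac{(-1)^{\ell n}q^{\ell n(n+1)/2}}{1-e^{2\pi iu}q^n},$$ $$\widehat A_\ell(u;\tau)=A_\ell(u;\tau)+\frac i2\sum_{m=0}^{\ell-1}e^{2\pi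 imu}\,\theta\Bigl(m\tau+\frac{\ell-1}2;\ell\tau\Bigr)R\Bigl(\ell u-m\tau-\frac{\ell-1}2;\ell\tau\Bigr),$$ $$\theta(z;\tau)=\sum_{\nu\in\frac12+\mathbb Z}e^{\pi i\nu^2\tau+2\pi i\nu(z+\frac12)},$$ $$R(u;\tau)=\sum_{\nu\in\frac12+\mathbb Z}\Bigl\{\operatorname{sgn}(\nu)-E\Bigl(\bigl(\nu+\tfrac{\operatorname{Im}u}{\operatorname{Im}\tau}\bigr)\sqrt{2\operatorname{Im}\tau}\Bigr)\Bigr\}(-1)^{\nu-\frac12}q^{-\nu^2/2}e^{-2\pi i\nu u}.$$ Here $\partial\widehat A_\ell(u;\tau)=\frac{\partial}{\partial u}\widehat A_\ell(u;\tau)$ with $\frac{\partial}{\partial u}=\frac12\bigl(\frac{\partial}{\partial\operatorname{Re}u}-i\frac{\partial}{\partial\operatorname{Im}u}\bigr)$; $\partial\widehat A_\ell(x\tau;\tau)$ is this derivative evaluated at $u=x\tau$, and $\partial\widehat A_\ell(-x)$ denotes the function $\tau\mapsto\partial\widehat A_\ell(-x;\tau)$. For $\gamma=\begin{pmatrix}a&b\\c&d\end{pmatrix}\in\mathrm{SL}_2(\mathbb Z)$, $\partial\widehat A_\ell(-x)\vert_2\gamma(\tau)=(c\tau+d)^{-2}\,\partial\widehat A_\ell\bigl(-x;\frac{a\tau+b}{c\tau+d}\bigr)$. *)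

theory Defs
  imports "HOL-Analysis.Analysis" "HOL-Number_Theory.Cong"
begin

text \<open>\<open>q_pow r \<tau>\<close> is $q^r = e^{2\pi i r\tau}$, with the exponent $r$ real.\<close>

definition q_pow :: "real \<Rightarrow> complex \<Rightarrow> complex" where
  "q_pow r \<tau> = exp (2 * of_real pi * \<i> * of_real r * \<tau>)"

text \<open>The interval integral is oriented, so this is also right for negative \<open>z\<close>.\<close>

definition zwegers_E :: "real \<Rightarrow> real" where
  "zwegers_E z = 2 * (LBINT u=ereal 0..ereal z. exp (- pi * u\<^sup>2))"

text \<open>
  The sums over $\nu \in \frac12 + \mathbb{Z}$ are indexed by the integer $n = \nu - \frac12$.
\<close>

definition zwegers_theta :: "complex \<Rightarrow> complex \<Rightarrow> complex" where
  "zwegers_theta z \<tau> =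
     (\<Sum>\<^sub>\<infinity>n::int. let \<nu> = of_int n + 1/2 in
        exp (of_real pi * \<i> * \<nu>\<^sup>2 * \<tau> + 2 * of_real pi * \<i> * \<nu> * (z + 1/2)))"

definition zwegers_R :: "complex \<Rightarrow> complex \<Rightarrow> complex" where
  "zwegers_R u \<tau> =
     (\<Sum>\<^sub>\<infinity>n::int. let \<nu> = (of_int n + 1/2 :: real) in
        of_real (sgn \<nu> - zwegers_E ((\<nu> + Im u / Im \<tau>) * sqrt (2 * Im \<tau>)))
        * (-1) powi n * q_pow (- (\<nu>\<^sup>2 / 2)) \<tau> * exp (- (2 * of_real pi * \<i> * of_real \<nu> * u)))"

text \<open>
  The level-\<open>l\<close> Appell function and its completion.  They are meaningful for \<open>Im \<tau> > 0\<close>,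
  \<open>l \<ge> 1\<close> and \<open>u\<close> outside the lattice $\mathbb{Z}\tau + \mathbb{Z}$.
\<close>

definition appell :: "nat \<Rightarrow> complex \<Rightarrow> complex \<Rightarrow> complex" where
  "appell l u \<tau> = exp (of_real pi * \<i> * of_nat l * u) *
     (\<Sum>\<^sub>\<infinity>n::int. (-1) powi (int l * n) * q_pow (real l * of_int n * (of_int n + 1) / 2) \<tau>
                 / (1 - exp (2 * of_real pi * \<i> * u) * q_pow (of_int n) \<tau>))"

definition appell_hat :: "nat \<Rightarrow> complex \<Rightarrow> complex \<Rightarrow> complex" where
  "appell_hat l u \<tau> = appell l u \<tau> + \<i> / 2 *
     (\<Sum>m = 0..<l. exp (2 * of_real pi * \<i> * of_nat m * u)
        * zwegers_theta (of_nat m * \<tau> + (of_nat l - 1) / 2) (of_nat l * \<tau>)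
        * zwegers_R (of_nat l * u - of_nat m * \<tau> - (of_nat l - 1) / 2) (of_nat l * \<tau>))"

text \<open>
  The Wirtinger derivative
  $\frac12(\frac{\partial}{\partial \mathrm{Re}\,u} - i \frac{\partial}{\partial \mathrm{Im}\,u})$.
\<close>

definition wirtinger :: "(complex \<Rightarrow> complex) \<Rightarrow> complex \<Rightarrow> complex" where
  "wirtinger f u = 1/2 *
     (vector_derivative (\<lambda>t::real. f (u + of_real t)) (at 0)
      - \<i> * vector_derivative (\<lambda>t::real. f (u + \<i> * of_real t)) (at 0))"

definition d_appell_hat :: "nat \<Rightarrow> complex \<Rightarrow> complex \<Rightarrow> complex" where
  "d_appell_hat l u \<tau> = wirtinger (\<lambda>w. appell_hat l w \<tau>) u"

definition mat2 :: "int \<Rightarrow> int \<Rightarrow> int \<Rightarrow> int \<Rightarrow> int^2^2" where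
  "mat2 a b c d = vector [vector [a, b], vector [c, d]]"

definition Gamma1 :: "nat \<Rightarrow> (int^2^2) set" where
  "Gamma1 k = {\<gamma>. det \<gamma> = 1 \<and> [\<gamma>$2$1 = 0] (mod int k)
                    \<and> [\<gamma>$1$1 = 1] (mod int k) \<and> [\<gamma>$2$2 = 1] (mod int k)}"

text \<open>The slash action of weight 2, for \<open>\<gamma>\<close> of determinant 1.\<close>

definition slash2 :: "(complex \<Rightarrow> complex) \<Rightarrow> int^2^2 \<Rightarrow> complex \<Rightarrow> complex" where
  "slash2 f \<gamma> \<tau> = (of_int (\<gamma>$2$1) * \<tau> + of_int (\<gamma>$2$2)) powi (-2)
     * f ((of_int (\<gamma>$1$1) * \<tau> + of_int (\<gamma>$1$2)) / (of_int (\<gamma>$2$1) * \<tau> + of_int (\<gamma>$2$2)))"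

definition g_fun :: "nat \<Rightarrow> real \<Rightarrow> complex \<Rightarrow> complex" where
  "g_fun l x \<tau> = q_pow (- (real l / 2 * x\<^sup>2)) \<tau> *
     (d_appell_hat l (of_real x * \<tau>) \<tau>
      - 2 * of_real pi * \<i> * of_nat l * of_real x * appell_hat l (of_real x * \<tau>) \<tau>)"

end

theory Submission
  imports Defs "HOL-Probability.Probability" "HOL-Complex_Analysis.Complex_Analysis"
begin

text \<open>
  The completion is a lattice sum that is visibly modular: with \<open>y = Im \<tau>\<close>, \<open>c = \<pi> l / y\<close> and
  \<open>\<lambda> = m \<tau> + n\<close>, it equals \<open>\<i> / (2 \<pi>) exp (c (u\<^sup>2 / 2 - \<bar>u\<bar>\<^sup>2))\<close> times the sum over all \<open>(m, n)\<close> of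
  \<open>(-1) ^ (l (m n + m + n)) exp (- c (cnj u \<lambda> + \<bar>\<lambda>\<bar>\<^sup>2 / 2)) / (u + \<lambda>)\<close>.
  To see this, fix \<open>m\<close> and apply Gaussian Poisson summation to the sum over \<open>n\<close>: the Fourier
  coefficients are differences of values of \<open>E\<close>, and Abel summation splits them into the \<open>m\<close>-th term
  of the Appell sum and the terms of the products of \<open>\<theta>\<close> and \<open>R\<close>.
  Differentiating termwise, both \<open>g\<close> and the derivative at \<open>- x\<close> become Eisenstein-like series over
  the lattice, for which the asserted transformations are reindexings.
\<close>

section \<open>The function \<open>E\<close>\<close>

text \<open>Neither the Appell sum nor R is modular by itself, and their transformation laws would
  bring in Mordell integrals; the lattice sum replaces all of that by one identity at fixed \<tau>.
  It arises by averaging a simple pole over the translations by \<lambda> with their automorphy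
  factors; the prefactor i / (2 pi) is the residue of the Appell sum at u = 0. The Gaussian makes
  the sum absolutely convergent, where a bare weight-two Eisenstein sum is not. Two obstacles shape
  the comparison with the definition. The summand of a row has a pole 1 / (w + n), so Poisson
  summation is applied only after that pole has been written as an integral over a period of a
  frequency. The resulting differences of E cannot be split into two sums directly, because E tends
  to 1 or - 1 while its exponential factor may grow; a sign function must be subtracted first, and
  the place where this sign jumps is what reproduces the Appell term.\<close>

lemma zwegers_E_has_real_derivative:
  "(zwegers_E has_real_derivative 2 * exp (- pi * x\<^sup>2)) (at x)"
proof -
  define a where "a = - \<bar>x\<bar> - 1"
  define b where "b = \<bar>x\<bar> + 1"
  have ab: "a < x" "x < b" "a \<le> 0" "0 \<le> b" unfolding a_def b_def by linarith+
  have "((\<lambda>u. LBINT y=ereal 0..ereal u. exp (- pi * y\<^sup>2)) has_vector_derivative exp (- pi * x\<^sup>2)) (at x within {a..b})"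
    using ab by (intro interval_integral_FTC2) (auto intro!: continuous_intros)
  moreover have "at x within {a..b} = at x"
    using ab by (intro at_within_interior) (auto simp: interior_atLeastAtMost_real)
  ultimately have "((\<lambda>u. LBINT y=ereal 0..ereal u. exp (- pi * y\<^sup>2)) has_real_derivative exp (- pi * x\<^sup>2)) (at x)"
    by (simp add: has_real_derivative_iff_has_vector_derivative)
  from DERIV_cmult[OF this, of 2] show ?thesis
    unfolding zwegers_E_def[abs_def] .
qed

lemma zwegers_E_0 [simp]: "zwegers_E 0 = 0"
  by (simp add: zwegers_E_def flip: zero_ereal_def)

lemma zwegers_E_minus: "zwegers_E (- x) = - zwegers_E x"
proof -
  have "((\<lambda>t. zwegers_E t + zwegers_E (- t)) has_real_derivative 0) (at t)" for t
    by (auto intro!: derivative_eq_intros zwegers_E_has_real_derivative[THEN DERIV_chain2])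
  hence "zwegers_E x + zwegers_E (- x) = zwegers_E 0 + zwegers_E (- 0)"
    using DERIV_isconst_all by blast
  thus ?thesis by simp
qed

lemma zwegers_E_tendsto_1: "(zwegers_E \<longlongrightarrow> 1) at_top"
proof -
  define f where "f = (\<lambda>u::real. indicator {0..} u *\<^sub>R exp (- pi * u\<^sup>2))"
  \<comment> \<open>The half-line integral of exp (- x^2) is sqrt pi / 2; the substitution by sqrt
    pi makes it 1 / 2, which the factor 2 in E normalises to 1.\<close>
  have "has_bochner_integral lborel (\<lambda>x. indicator {0..} (0 + sqrt pi * x) *\<^sub>R exp (- (0 + sqrt pi * x)\<^sup>2) :: real) ((sqrt pi / 2) /\<^sub>R \<bar>sqrt pi\<bar>)"
    by (rule lborel_has_bochner_integral_real_affine_iff[THEN iffD1, OF _ gaussian_moment_0, of "sqrt pi" 0]) auto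
  moreover have "\<not> pi \<le> 0" using pi_gt_zero by linarith
  hence "(\<lambda>x. indicator {0..} (0 + sqrt pi * x) *\<^sub>R exp (- (0 + sqrt pi * x)\<^sup>2) :: real) = f"
    by (auto simp: fun_eq_iff f_def indicator_def power_mult_distrib zero_le_mult_iff)
  ultimately have f: "has_bochner_integral lborel f (1/2)"
    by (simp add: field_simps)
  have "((\<lambda>y. \<integral> x. indicator {..y} x *\<^sub>R f x \<partial>lborel) \<longlongrightarrow> \<integral> x. f x \<partial>lborel) at_top"
    using f by (intro tendsto_integral_at_top) (auto simp: has_bochner_integral_iff)
  also have "(\<integral> x. f x \<partial>lborel) = 1 / 2"
    using f by (rule has_bochner_integral_integral_eq)
  finally have lim: "((\<lambda>y. \<integral> x. indicator {..y} x *\<^sub>R f x \<partial>lborel) \<longlongrightarrow> 1 / 2) at_top" .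
  have "2 * (\<integral> x. indicator {..y} x *\<^sub>R f x \<partial>lborel) = zwegers_E y" if "y \<ge> 0" for y
  proof -
    have "(\<integral> x. indicator {..y} x *\<^sub>R f x \<partial>lborel) = (LINT x:{0..y}|lborel. exp (- pi * x\<^sup>2))"
      unfolding set_lebesgue_integral_def f_def by (intro Bochner_Integration.integral_cong) (auto simp: indicator_def)
    also have "\<dots> = (LBINT u=ereal 0..ereal y. exp (- pi * u\<^sup>2))"
      using that by (simp add: interval_integral_Icc)
    finally show ?thesis by (simp add: zwegers_E_def)
  qed
  hence "\<forall>\<^sub>F y in at_top. 2 * (\<integral> x. indicator {..y} x *\<^sub>R f x \<partial>lborel) = zwegers_E y"
    by (auto simp: eventually_at_top_linorder)
  moreover have "((\<lambda>y. 2 * (\<integral> x. indicator {..y} x *\<^sub>R f x \<partial>lborel)) \<longlongrightarrow> 2 * (1/2)) at_top"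
    by (intro tendsto_intros lim)
  ultimately show ?thesis
    by (simp add: filterlim_cong)
qed

lemma zwegers_E_mono: "a \<le> b \<Longrightarrow> zwegers_E a \<le> zwegers_E b"
  by (rule DERIV_nonneg_imp_nondecreasing) (auto intro!: exI zwegers_E_has_real_derivative)

lemma zwegers_E_le_1: "zwegers_E x \<le> 1"
  by (rule tendsto_lowerbound[OF zwegers_E_tendsto_1])
     (auto simp: eventually_at_top_linorder intro!: exI[of _ x] zwegers_E_mono)

lemma abs_zwegers_E_le_1: "\<bar>zwegers_E x\<bar> \<le> 1"
  using zwegers_E_le_1[of x] zwegers_E_le_1[of "- x"] by (simp add: zwegers_E_minus abs_le_iff)

text \<open>From 1 / pi on, E(t) - 1 + exp (- pi t^2) decreases, its derivative carrying the factor
  1 - pi t, and it tends to 0; so the bound holds there even with constant 1. Below 1 / pi the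
  Gaussian is at least 1 / 2 and the left side at most 1, which is where the constant 2 comes
  from.\<close>

lemma one_minus_zwegers_E_le:
  assumes "x \<ge> 0"
  shows "1 - zwegers_E x \<le> 2 * exp (- pi * x\<^sup>2)"
proof (cases "x \<ge> 1 / pi")
  case True
  define f where "f = (\<lambda>t. zwegers_E t - 1 + exp (- pi * t\<^sup>2))"
  have f': "(f has_real_derivative 2 * (1 - pi * t) * exp (- pi * t\<^sup>2)) (at t)" for t
    unfolding f_def
    by (auto intro!: derivative_eq_intros zwegers_E_has_real_derivative simp: algebra_simps)
  have dec: "f b \<le> f x" if "x \<le> b" for b
  proof (rule DERIV_nonpos_imp_nonincreasing[OF that])
    fix t assume "x \<le> t" "t \<le> b"
    have "1 \<le> pi * x" using True by (simp add: field_simps)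
    also have "\<dots> \<le> pi * t" using \<open>x \<le> t\<close> by simp
    finally have "1 \<le> pi * t" .
    thus "\<exists>y. DERIV f t :> y \<and> y \<le> 0"
      using f' by (intro exI conjI) (auto intro!: mult_nonpos_nonneg)
  qed
  have "((\<lambda>t::real. exp (- pi * t\<^sup>2)) \<longlongrightarrow> 0) at_top"
    by real_asymp
  hence "(f \<longlongrightarrow> 1 - 1 + 0) at_top"
    unfolding f_def by (intro tendsto_intros zwegers_E_tendsto_1)
  hence "f x \<ge> 0"
    by (intro tendsto_upperbound[of f]) (auto simp: eventually_at_top_linorder intro!: exI[of _ x] dec)
  thus ?thesis unfolding f_def using exp_ge_zero[of "- pi * x\<^sup>2"] by linarith
next
  case False
  have "x * pi < 1" using False by (simp add: field_simps)
  hence "x * pi * x \<le> 1 * x" using assms by (intro mult_right_mono) auto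
  moreover have "x \<le> 1 / 2"
    using False pi_gt3 assms by (smt (verit) frac_le)
  ultimately have "1 + (- pi * x\<^sup>2) \<ge> 1 / 2"
    by (simp add: power2_eq_square mult_ac)
  moreover have "exp (- pi * x\<^sup>2) \<ge> 1 + (- pi * x\<^sup>2)"
    by (rule exp_ge_add_one_self)
  moreover have "zwegers_E x \<ge> 0"
    using zwegers_E_mono[OF assms] by simp
  ultimately show ?thesis by linarith
qed

text \<open>In R the sign is taken at \<nu> but E at a shifted point. Where the shift does not
  change the sign, the tail bound applies; otherwise |x + d| \<le> |d|, and exp (pi d^2) lifts the
  right side to at least 2, the trivial bound.\<close>

lemma abs_sgn_minus_zwegers_E_le:
  assumes "x \<noteq> 0"
  shows "\<bar>sgn x - zwegers_E (x + d)\<bar> \<le> 2 * exp (pi * d\<^sup>2) * exp (- pi * (x + d)\<^sup>2)"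
proof -
  have *: "\<bar>1 - zwegers_E (x + e)\<bar> \<le> 2 * exp (pi * e\<^sup>2) * exp (- pi * (x + e)\<^sup>2)" if "x > 0" for x e
  proof (cases "x + e \<ge> 0")
    case True
    have "2 * exp (- pi * (x + e)\<^sup>2) \<le> 2 * exp (pi * e\<^sup>2) * exp (- pi * (x + e)\<^sup>2)" by simp
    with one_minus_zwegers_E_le[OF True] zwegers_E_le_1[of "x + e"] show ?thesis
      by linarith
  next
    case False
    hence "(- (x + e))\<^sup>2 \<le> (- e)\<^sup>2" using that by (intro power_mono) auto
    hence "pi * (x + e)\<^sup>2 \<le> pi * e\<^sup>2" unfolding power2_minus by (intro mult_left_mono) auto
    hence "1 \<le> exp (pi * e\<^sup>2 + - pi * (x + e)\<^sup>2)" by simp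
    also have "\<dots> = exp (pi * e\<^sup>2) * exp (- pi * (x + e)\<^sup>2)"
      by (rule exp_add)
    finally show ?thesis
      using abs_zwegers_E_le_1[of "x + e"] by linarith
  qed
  show ?thesis
  proof (cases "x > 0")
    case True
    thus ?thesis using * by simp
  next
    case False
    hence "\<bar>sgn x - zwegers_E (x + d)\<bar> = \<bar>1 - zwegers_E (- x + - d)\<bar>"
      using zwegers_E_minus[of "x + d"] assms by (simp add: sgn_if)
    also have "\<dots> \<le> 2 * exp (pi * (- d)\<^sup>2) * exp (- pi * (- x + - d)\<^sup>2)"
      by (rule *) (use False assms in auto)
    also have "(- x + - d)\<^sup>2 = (x + d)\<^sup>2" by (simp add: power2_eq_square algebra_simps)
    finally show ?thesis unfolding power2_minus .
  qed
qed

section \<open>Uniqueness of Fourier coefficients\<close>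

lemma gaussian_int_summable:
  fixes a b :: real
  assumes "a > 0"
  shows "(\<lambda>n::int. exp (- a * (of_int n)\<^sup>2 + b * of_int n)) summable_on UNIV"
proof -
  \<comment> \<open>\<open>C\<close> is exp of the maximum of (|b| + 1) t - a t^2. Splitting it off
    leaves - |x| in the exponent, hence a geometric majorant.\<close>
  define C where "C = exp ((\<bar>b\<bar> + 1)\<^sup>2 / (4 * a))"
  have bound: "exp (- a * x\<^sup>2 + b * x) \<le> C * exp (- \<bar>x\<bar>)" for x :: real
  proof -
    have "b * x \<le> \<bar>b\<bar> * \<bar>x\<bar>" by (metis abs_ge_self abs_mult)
    moreover have "a * (y - k / (2 * a))\<^sup>2 = a * y\<^sup>2 - k * y + k\<^sup>2 / (4 * a)" for k y
      using assms by (simp add: power2_eq_square field_simps)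
    from this[of "\<bar>x\<bar>" "\<bar>b\<bar> + 1"] have "(\<bar>b\<bar> + 1) * \<bar>x\<bar> \<le> a * x\<^sup>2 + (\<bar>b\<bar> + 1)\<^sup>2 / (4 * a)"
      using assms mult_nonneg_nonneg[of a "(\<bar>x\<bar> - (\<bar>b\<bar> + 1) / (2 * a))\<^sup>2"] by simp
    ultimately have "- a * x\<^sup>2 + b * x \<le> (\<bar>b\<bar> + 1)\<^sup>2 / (4 * a) + - \<bar>x\<bar>"
      by (simp add: algebra_simps)
    thus ?thesis unfolding C_def by (subst exp_add[symmetric]) simp
  qed
  have geo: "(\<lambda>n::nat. exp (- real n)) summable_on UNIV"
  proof -
    have "summable (\<lambda>n::nat. exp (- 1 :: real) ^ n)"
      by (intro summable_geometric) auto
    hence "summable (\<lambda>n::nat. exp (- real n))"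
      by (simp flip: exp_of_nat_mult)
    thus ?thesis by (intro summable_nonneg_imp_summable_on) auto
  qed
  have 1: "(\<lambda>n::int. exp (- \<bar>real_of_int n\<bar>)) summable_on {0..}"
    using geo by (subst summable_on_reindex_bij_witness[of _ int nat UNIV "\<lambda>n. exp (- real n)"]) auto
  have 2: "(\<lambda>n::int. exp (- \<bar>real_of_int n\<bar>)) summable_on {..0}"
    using geo by (subst summable_on_reindex_bij_witness[of _ "\<lambda>n. - int n" "\<lambda>n. nat (- n)" UNIV "\<lambda>n. exp (- real n)"]) auto
  have "(\<lambda>n::int. exp (- \<bar>real_of_int n\<bar>)) summable_on {0..} \<union> {..0}"
    by (rule summable_on_union[OF 1 2])
  also have "{0..} \<union> {..0} = (UNIV :: int set)" by auto
  finally have "(\<lambda>n::int. C * exp (- \<bar>real_of_int n\<bar>)) summable_on UNIV"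
    by (rule summable_on_cmult_right)
  thus ?thesis by (rule summable_on_comparison_test[OF _ bound exp_ge_zero])
qed

text \<open>Turns unordered sums over the integers into limits along blocks. The blocks are
  half-open because the unit intervals [n, n + 1] with - N \<le> n < N tile [- N, N].\<close>

lemma filterlim_int_intervals:
  "filterlim (\<lambda>N::nat. {- int N..<int N}) (finite_subsets_at_top UNIV) sequentially"
  unfolding filterlim_iff eventually_finite_subsets_at_top
proof safe
  fix P X assume *: "finite X" "\<forall>Y. finite Y \<and> X \<subseteq> Y \<and> Y \<subseteq> (UNIV :: int set) \<longrightarrow> P Y"
  define M where "M = Max (insert 0 (abs ` X))"
  have M: "\<bar>x\<bar> \<le> M" if "x \<in> X" for x
    unfolding M_def using that \<open>finite X\<close> by (intro Max_ge) auto
  have "P {- int N..<int N}" if "N \<ge> nat (M + 1)" for N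
  proof -
    have "x \<in> {- int N..<int N}" if "x \<in> X" for x
      using M[OF that] \<open>N \<ge> nat (M + 1)\<close> by auto
    thus ?thesis by (intro *(2)[rule_format]) auto
  qed
  thus "\<forall>\<^sub>F N in sequentially. P {- int N..<int N}"
    by (auto simp: eventually_at_top_linorder)
qed

text \<open>Transported to the unit circle, \<open>D\<close> is uniformly close to a polynomial in
  Re z and Im z. On the circle this is a trigonometric polynomial, so \<open>D\<close> times its
  conjugate integrates to 0, and the integral of |D|^2 is arbitrarily small.\<close>

lemma fourier_uniqueness:
  fixes D :: "real \<Rightarrow> complex"
  assumes cont: "continuous_on {0..1} D" and per: "D 0 = D 1"
    and zero: "\<And>k::int. integral {0..1} (\<lambda>s. D s * exp (2 * pi * \<i> * of_int k * of_real s)) = 0"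
    and s: "s \<in> {0..1}"
  shows "D s = 0"
proof -
  define e where "e = (\<lambda>s::real. exp (2 * pi * \<i> * of_real s))"
  have e_pow: "exp (2 * pi * \<i> * of_int k * of_real s) = e s powi k" for k s
    by (simp add: e_def exp_power_int mult_ac)
  have e_norm: "norm (e s) = 1" for s by (simp add: e_def norm_exp_eq_Re)
  have e_nz: "e s \<noteq> 0" for s by (simp add: e_def)
  have cnj_e: "cnj (e s) = e s powi (-1)" for s
    using complex_norm_square[of "e s"] e_norm[of s] e_nz[of s]
    by (simp add: power_int_minus field_simps)
  have [continuous_intros]: "continuous_on A e" for A
    unfolding e_def by (intro continuous_intros)
  have e_0: "e 0 = 1" by (simp add: e_def)
  have e_1: "e 1 = 1" unfolding e_def using exp_two_pi_i by (simp add: mult_ac)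
  \<comment> \<open>Vanishing of all coefficients, unlike vanishing of one integral, survives
    multiplication by powers of \<open>e\<close>; this makes the induction over polynomial functions
    in \<open>Z_poly\<close> go through.\<close>
  define Z where "Z = {h. continuous_on {0..1} h \<and> (\<forall>k::int. integral {0..1} (\<lambda>s. h s * e s powi k) = 0)}"
  have Z_shift: "(\<lambda>s. h s * (c * e s powi j)) \<in> Z" if "h \<in> Z" for h c j
  proof -
    have "integral {0..1} (\<lambda>s. h s * (c * e s powi j) * e s powi k) = 0" for k
    proof -
      have "(\<lambda>s. h s * (c * e s powi j) * e s powi k) = (\<lambda>s. c * (h s * e s powi (j + k)))"
        using e_nz by (auto simp: power_int_add fun_eq_iff)
      thus ?thesis using that by (simp add: Z_def)
    qed
    thus ?thesis using that e_nz by (auto simp: Z_def intro!: continuous_intros)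
  qed
  have Z_add: "(\<lambda>s. f s + g s) \<in> Z" if "f \<in> Z" "g \<in> Z" for f g
  proof -
    have "integral {0..1} (\<lambda>s. (f s + g s) * e s powi k) = 0" for k
    proof -
      have "(\<lambda>s. f s * e s powi k) integrable_on {0..1}" "(\<lambda>s. g s * e s powi k) integrable_on {0..1}"
        using that e_nz by (auto simp: Z_def intro!: integrable_continuous_interval continuous_intros)
      thus ?thesis using that by (simp add: Z_def distrib_right Henstock_Kurzweil_Integration.integral_add)
    qed
    thus ?thesis using that by (auto simp: Z_def intro!: continuous_intros)
  qed
  have Z_poly: "(\<lambda>s. h s * of_real (g (e s))) \<in> Z" if "real_polynomial_function g" "h \<in> Z" for g h
    using that
  proof (induction arbitrary: h rule: real_polynomial_function.induct)
    case (linear f)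
    define a b where "a = f 1" and "b = f \<i>"
    \<comment> \<open>Writes a real linear form in terms of z and its conjugate, which on the circle
      is z^(-1), so that only shifts of the Fourier index occur.\<close>
    define c where "c = Complex (a / 2) (- (b / 2))"
    have "f z = Re z * a + Im z * b" for z
    proof -
      have "f z = f (Re z *\<^sub>R 1 + Im z *\<^sub>R \<i>)"
        by (rule arg_cong[where f = f]) (simp add: complex_eq_iff)
      also have "\<dots> = Re z * a + Im z * b"
        unfolding linear_add[OF bounded_linear.linear[OF linear(1)]]
          linear_scale[OF bounded_linear.linear[OF linear(1)]] a_def b_def real_scaleR_def ..
      finally show ?thesis .
    qed
    hence f: "of_real (f z) = c * z + cnj c * cnj z" for z
      by (simp add: complex_eq_iff c_def algebra_simps)
    have "(\<lambda>s. h s * (c * e s powi 1) + h s * (cnj c * e s powi (-1))) \<in> Z"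
      by (intro Z_add Z_shift linear)
    thus ?case unfolding f cnj_e by (simp add: algebra_simps)
  next
    case (const c)
    thus ?case using Z_shift[of h "of_real c" 0] by simp
  next
    case (add f g)
    have "(\<lambda>s. h s * of_real (f (e s)) + h s * of_real (g (e s))) \<in> Z"
      by (intro Z_add add)
    thus ?case by (simp add: algebra_simps)
  next
    case (mult f g)
    have "(\<lambda>s. h s * of_real (f (e s)) * of_real (g (e s))) \<in> Z"
      by (intro mult)
    thus ?case by (simp add: algebra_simps)
  qed
  have D: "D \<in> Z" using cont zero by (simp add: Z_def flip: e_pow)
  define F where "F = (\<lambda>z. D (Arg2pi z / (2 * pi)))"
  have F_e: "F (e s) = D s" if "s \<in> {0..1}" for s
  proof (cases "s = 1")
    case True
    thus ?thesis using per Arg2pi_of_real[of 1] by (simp add: F_def e_1)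
  next
    case False
    have "Arg2pi (e s) = 2 * pi * s"
      unfolding e_def using that False by (subst Arg2pi_exp) auto
    thus ?thesis by (simp add: F_def)
  qed
  have onto: "\<exists>s\<in>{0..1}. z = e s" if "norm z = 1" for z
  proof -
    have "z = e (Arg2pi z / (2 * pi))"
      using that complex_norm_eq_1_exp[of z] by (simp add: e_def mult_ac)
    moreover have "Arg2pi z / (2 * pi) \<in> {0..1}"
      using Arg2pi[of z] by auto
    ultimately show ?thesis by blast
  qed
  \<comment> \<open>\<open>Arg2pi\<close> jumps at 1. Continuity is obtained instead from
    \<open>e\<close> acting as a quotient map: preimages of closed sets under \<open>F\<close> are
    images of compact sets under \<open>e\<close>. Periodicity enters through
    \<open>F_e\<close>.\<close>
  have F_cont: "continuous_on (sphere 0 1) F"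
    unfolding continuous_on_closed_vimage[OF closed_sphere]
  proof safe
    fix B :: "complex set" assume "closed B"
    have "F -` B \<inter> sphere 0 1 = e ` (D -` B \<inter> {0..1})"
    proof (intro equalityI subsetI)
      fix z assume z: "z \<in> F -` B \<inter> sphere 0 1"
      hence "norm z = 1" by simp
      then obtain s where "s \<in> {0..1}" "z = e s" using onto by blast
      thus "z \<in> e ` (D -` B \<inter> {0..1})" using z F_e by auto
    next
      fix z assume "z \<in> e ` (D -` B \<inter> {0..1})"
      thus "z \<in> F -` B \<inter> sphere 0 1" using F_e e_norm by auto
    qed
    moreover have "closed (D -` B \<inter> {0..1})"
      using cont \<open>closed B\<close> by (auto simp: continuous_on_closed_vimage)
    hence "compact (D -` B \<inter> {0..1})"
      using bounded_subset[OF compact_imp_bounded[OF compact_Icc[of 0 1]], of "D -` B \<inter> {0..1}"]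
      by (simp add: compact_eq_bounded_closed)
    hence "compact (e ` (D -` B \<inter> {0..1}))"
      by (intro compact_continuous_image continuous_intros)
    ultimately show "closed (F -` B \<inter> sphere 0 1)"
      by (simp add: compact_imp_closed)
  qed
  have D_int: "continuous_on {0..1} (\<lambda>s. norm (D s))" using cont by (intro continuous_intros)
  define I where "I = integral {0..1} (\<lambda>s. (norm (D s))\<^sup>2)"
  define M where "M = integral {0..1} (\<lambda>s. norm (D s))"
  have "M \<ge> 0" unfolding M_def by (intro integral_nonneg integrable_continuous_interval D_int) auto
  have small: "I \<le> 2 * d * M" if "d > 0" for d
  proof -
    obtain p where p: "real_polynomial_function p" "\<And>z. z \<in> sphere 0 1 \<Longrightarrow> \<bar>Re (F z) - p z\<bar> < d"
      by (rule Stone_Weierstrass_real_polynomial_function[of "sphere 0 1" "\<lambda>z. Re (F z)" d])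
         (use F_cont \<open>d > 0\<close> in \<open>auto intro!: continuous_intros\<close>)
    obtain q where q: "real_polynomial_function q" "\<And>z. z \<in> sphere 0 1 \<Longrightarrow> \<bar>Im (F z) - q z\<bar> < d"
      by (rule Stone_Weierstrass_real_polynomial_function[of "sphere 0 1" "\<lambda>z. Im (F z)" d])
         (use F_cont \<open>d > 0\<close> in \<open>auto intro!: continuous_intros\<close>)
    \<comment> \<open>\<open>p + \<i> q\<close> approximates \<open>F\<close>, so \<open>G\<close>,
      which is \<open>D\<close> times the conjugate, approximates |D|^2 while its integral
      vanishes.\<close>
    define G where "G = (\<lambda>s. D s * of_real (p (e s)) + D s * of_real (q (e s)) * (- \<i> * e s powi 0))"
    have "G \<in> Z" unfolding G_def
      by (intro Z_add Z_shift Z_poly D p(1) q(1))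
    hence G: "continuous_on {0..1} G" "integral {0..1} G = 0"
      by (auto simp: Z_def dest: spec[of _ 0])
    have "of_real I = integral {0..1} (\<lambda>s. of_real ((norm (D s))\<^sup>2) :: complex)"
      unfolding I_def by (rule integral_linear[OF _ bounded_linear_of_real, unfolded o_def, symmetric])
        (intro integrable_continuous_interval continuous_intros D_int)
    also have "\<dots> = integral {0..1} (\<lambda>s. of_real ((norm (D s))\<^sup>2) - G s)"
      using G by (subst Henstock_Kurzweil_Integration.integral_diff)
        (auto intro!: integrable_continuous_interval continuous_intros cont)
    finally have "norm (of_real I :: complex) = norm (integral {0..1} (\<lambda>s. of_real ((norm (D s))\<^sup>2) - G s))"
      by simp
    also have "\<dots> \<le> integral {0..1} (\<lambda>s. 2 * d * norm (D s))"
    proof (rule integral_norm_bound_integral)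
      fix s :: real assume s: "s \<in> {0..1}"
      define r where "r = D s - (of_real (p (e s)) + \<i> * of_real (q (e s)))"
      have "of_real ((norm (D s))\<^sup>2) - G s = D s * cnj r"
        using complex_norm_square[of "D s"] by (simp add: G_def r_def algebra_simps)
      hence "norm (of_real ((norm (D s))\<^sup>2) - G s) = norm (D s) * norm r"
        by (simp only: norm_mult complex_mod_cnj)
      moreover have "norm r \<le> 2 * d"
        using cmod_le[of r] p(2)[of "e s"] q(2)[of "e s"] e_norm[of s] F_e[OF s]
        by (simp add: r_def)
      hence "norm (D s) * norm r \<le> norm (D s) * (2 * d)" by (rule mult_left_mono) simp
      ultimately show "norm (of_real ((norm (D s))\<^sup>2) - G s) \<le> 2 * d * norm (D s)"
        by (simp only: mult.commute)
    qed (use G in \<open>auto intro!: integrable_continuous_interval continuous_intros cont\<close>)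
    also have "\<dots> = 2 * d * M" by (simp add: M_def)
    finally show ?thesis by simp
  qed
  have "I \<le> 0"
  proof (rule field_le_epsilon)
    fix \<epsilon> :: real assume "\<epsilon> > 0"
    hence "I \<le> 2 * (\<epsilon> / (2 * (M + 1))) * M" using \<open>M \<ge> 0\<close> by (intro small) auto
    also have "\<dots> \<le> \<epsilon>" using \<open>\<epsilon> > 0\<close> \<open>M \<ge> 0\<close> by (simp add: field_simps)
    finally show "I \<le> 0 + \<epsilon>" by simp
  qed
  have "(norm (D s))\<^sup>2 = 0"
  proof (rule ccontr)
    assume "(norm (D s))\<^sup>2 \<noteq> 0"
    have "I = 0" using \<open>I \<le> 0\<close> unfolding I_def
      by (intro antisym integral_nonneg integrable_continuous_interval continuous_intros D_int) auto
    moreover have "(\<lambda>s. (norm (D s))\<^sup>2) integrable_on {0..1}"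
      by (intro integrable_continuous_interval continuous_intros D_int)
    ultimately have "((\<lambda>s. (norm (D s))\<^sup>2) has_integral 0) (cbox 0 1)"
      by (simp add: I_def has_integral_iff)
    hence "(norm (D s))\<^sup>2 = 0"
      by (rule has_integral_0_cbox_imp_0[rotated 2]) (use s D_int in \<open>auto intro!: continuous_intros\<close>)
    thus False using \<open>(norm (D s))\<^sup>2 \<noteq> 0\<close> by simp
  qed
  thus ?thesis by simp
qed

section \<open>Poisson summation for Gaussians\<close>

text \<open>This is the characteristic function of the standard normal distribution, rescaled by c =
  sqrt (2 \<alpha>) so that \<alpha> s^2 becomes half a square.\<close>

lemma gaussian_fourier_integral:
  fixes \<alpha> \<kappa> :: real
  assumes "\<alpha> > 0"
  shows "has_bochner_integral lborel (\<lambda>s. exp (of_real (- \<alpha> * s\<^sup>2) + \<i> * of_real (\<kappa> * s)))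
           (of_real (sqrt (pi / \<alpha>) * exp (- \<kappa>\<^sup>2 / (4 * \<alpha>))))"
proof -
  define c where "c = sqrt (2 * \<alpha>)"
  define t where "t = \<kappa> / c"
  have c: "c > 0" "c\<^sup>2 = 2 * \<alpha>" using assms by (auto simp: c_def)
  have int: "integrable lborel (\<lambda>x. std_normal_density x *\<^sub>R iexp (t * x))"
    by (rule Bochner_Integration.integrable_bound[OF integrable_normal_density[where \<mu> = 0 and \<sigma> = 1]]) auto
  have "(\<integral>x. std_normal_density x *\<^sub>R iexp (t * x) \<partial>lborel) = char std_normal_distribution t"
    unfolding char_def by (subst integral_density) auto
  also have "\<dots> = of_real (exp (- t\<^sup>2 / 2))"
    by (simp add: char_std_normal_distribution)
  finally have "has_bochner_integral lborel (\<lambda>x. std_normal_density x *\<^sub>R iexp (t * x)) (of_real (exp (- t\<^sup>2 / 2)))"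
    using int by (simp add: has_bochner_integral_iff)
  hence "has_bochner_integral lborel (\<lambda>s. std_normal_density (0 + c * s) *\<^sub>R iexp (t * (0 + c * s))) (of_real (exp (- t\<^sup>2 / 2)) /\<^sub>R \<bar>c\<bar>)"
    using c by (subst lborel_has_bochner_integral_real_affine_iff[symmetric]) auto
  hence "has_bochner_integral lborel (\<lambda>s. of_real (sqrt (2 * pi)) * (std_normal_density (0 + c * s) *\<^sub>R iexp (t * (0 + c * s))))
           (of_real (sqrt (2 * pi)) * (of_real (exp (- t\<^sup>2 / 2)) /\<^sub>R \<bar>c\<bar>) :: complex)"
    by (rule has_bochner_integral_mult_right)
  moreover have "of_real (sqrt (2 * pi)) * (std_normal_density (0 + c * s) *\<^sub>R iexp (t * (0 + c * s)))
      = exp (of_real (- \<alpha> * s\<^sup>2) + \<i> * of_real (\<kappa> * s))" for s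
  proof -
    have "std_normal_density (c * s) = (1 / sqrt (2 * pi)) * exp (- \<alpha> * s\<^sup>2)"
      using c by (simp add: std_normal_density_def power_mult_distrib)
    moreover have "t * (c * s) = \<kappa> * s" using c by (simp add: t_def)
    ultimately show ?thesis
      by (simp only: add_0_left exp_add exp_of_real scaleR_conv_of_real) simp
  qed
  moreover have "of_real (sqrt (2 * pi)) * (of_real (exp (- t\<^sup>2 / 2)) /\<^sub>R \<bar>c\<bar>)
      = (of_real (sqrt (pi / \<alpha>) * exp (- \<kappa>\<^sup>2 / (4 * \<alpha>))) :: complex)"
  proof -
    have "t\<^sup>2 / 2 = \<kappa>\<^sup>2 / (4 * \<alpha>)" using c by (simp add: t_def power_divide)
    moreover have "sqrt (2 * pi) / c = sqrt (pi / \<alpha>)"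
      using assms by (simp add: c_def real_sqrt_divide real_sqrt_mult)
    moreover have "of_real (sqrt (2 * pi)) * (of_real (exp (- t\<^sup>2 / 2)) /\<^sub>R \<bar>c\<bar>)
      = (of_real (sqrt (2 * pi) / c * exp (- (t\<^sup>2 / 2))) :: complex)"
      using c by (simp add: scaleR_conv_of_real divide_simps)
    ultimately show ?thesis by simp
  qed
  ultimately show ?thesis by simp
qed

lemma integral_infsum_uniform:
  fixes f :: "'i \<Rightarrow> real \<Rightarrow> complex"
  assumes cont: "\<And>n. continuous_on {a..b} (f n)"
    and bound: "\<And>n s. s \<in> {a..b} \<Longrightarrow> norm (f n s) \<le> M n" and M: "M summable_on UNIV"
  shows "continuous_on {a..b} (\<lambda>s. \<Sum>\<^sub>\<infinity>n. f n s)"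
    and "((\<lambda>n. integral {a..b} (f n)) has_sum integral {a..b} (\<lambda>s. \<Sum>\<^sub>\<infinity>n. f n s)) UNIV"
proof -
  have ul: "uniform_limit {a..b} (\<lambda>X s. \<Sum>n\<in>X. f n s) (\<lambda>s. \<Sum>\<^sub>\<infinity>n. f n s) (finite_subsets_at_top UNIV)"
    by (rule Weierstrass_m_test_general[OF _ M]) (use bound in auto)
  have c: "continuous_on {a..b} (\<lambda>s. \<Sum>n\<in>X. f n s)" for X
    by (intro continuous_intros cont)
  show "continuous_on {a..b} (\<lambda>s. \<Sum>\<^sub>\<infinity>n. f n s)"
    by (rule uniform_limit_theorem[OF _ ul]) (use c in auto)
  obtain I J where I: "\<And>X. ((\<lambda>s. \<Sum>n\<in>X. f n s) has_integral I X) {a..b}"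
    and J: "((\<lambda>s. \<Sum>\<^sub>\<infinity>n. f n s) has_integral J) {a..b}" and "(I \<longlongrightarrow> J) (finite_subsets_at_top UNIV)"
    using uniform_limit_integral[OF ul c] by auto
  moreover have "I X = (\<Sum>n\<in>X. integral {a..b} (f n))" if "finite X" for X
    using integral_unique[OF I[of X]] that
    by (simp add: integral_sum integrable_continuous_interval cont)
  hence "\<forall>\<^sub>F X in finite_subsets_at_top UNIV. I X = (\<Sum>n\<in>X. integral {a..b} (f n))"
    by (auto intro: eventually_finite_subsets_at_top_weakI)
  ultimately show "((\<lambda>n. integral {a..b} (f n)) has_sum integral {a..b} (\<lambda>s. \<Sum>\<^sub>\<infinity>n. f n s)) UNIV"
    unfolding has_sum_def integral_unique[OF J] using tendsto_cong by blast
qed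

lemma integral_exp_int:
  "integral {0..1} (\<lambda>s. exp (2 * pi * \<i> * of_int k * of_real s)) = (if k = 0 then 1 else 0)"
proof (cases "k = 0")
  case False
  define c where "c = 2 * pi * \<i> * of_int k"
  have "c \<noteq> 0" using False by (simp add: c_def)
  have "((\<lambda>z. exp (c * z) / c) has_field_derivative exp (c * z)) (at z)" for z
    using \<open>c \<noteq> 0\<close> by (auto intro!: derivative_eq_intros)
  hence "((\<lambda>s. exp (c * of_real s)) has_integral exp (c * of_real 1) / c - exp (c * of_real 0) / c) {0..1}"
    by (intro fundamental_theorem_of_calculus has_vector_derivative_real_field) auto
  moreover have "exp c = 1"
    unfolding c_def by (simp add: exp_eq_1)
  ultimately show ?thesis using False by (simp add: c_def integral_unique)
qed simp

text \<open>A majorant independent of the shift s: (s + x)^2 is at least x^2 for x \<ge> 0 and at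
  least x^2 + 2 x for x < 0. Adding both exponentials spares a division of the later sums by
  sign.\<close>

lemma gaussian_norm_bound:
  fixes \<alpha> s x \<kappa> :: real
  assumes "\<alpha> > 0" "s \<in> {0..1}"
  shows "norm (exp (of_real (- \<alpha> * (s + x)\<^sup>2) + \<i> * of_real \<kappa>)) \<le> exp (- \<alpha> * x\<^sup>2 + (- 2 * \<alpha>) * x) + exp (- \<alpha> * x\<^sup>2 + 0 * x)"
proof -
  have "- \<alpha> * (s + x)\<^sup>2 \<le> - \<alpha> * x\<^sup>2 + (- 2 * \<alpha>) * x \<or> - \<alpha> * (s + x)\<^sup>2 \<le> - \<alpha> * x\<^sup>2 + 0 * x"
  proof (cases "x \<ge> 0")
    case True
    hence "x\<^sup>2 \<le> (s + x)\<^sup>2" using assms by (intro power_mono) auto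
    thus ?thesis using assms by simp
  next
    case False
    hence "0 \<le> s\<^sup>2 + (- x) * (2 * (1 - s))" using assms by (intro add_nonneg_nonneg mult_nonneg_nonneg) auto
    hence "x\<^sup>2 + 2 * x \<le> (s + x)\<^sup>2" by (simp add: power2_eq_square algebra_simps)
    hence "\<alpha> * (x\<^sup>2 + 2 * x) \<le> \<alpha> * (s + x)\<^sup>2" using assms by (intro mult_left_mono) auto
    thus ?thesis by (simp add: algebra_simps)
  qed
  hence "exp (- \<alpha> * (s + x)\<^sup>2) \<le> exp (- \<alpha> * x\<^sup>2 + (- 2 * \<alpha>) * x) \<or> exp (- \<alpha> * (s + x)\<^sup>2) \<le> exp (- \<alpha> * x\<^sup>2 + 0 * x)"
    by simp
  moreover have "norm (exp (of_real (- \<alpha> * (s + x)\<^sup>2) + \<i> * of_real \<kappa>)) = exp (- \<alpha> * (s + x)\<^sup>2)"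
    by (simp add: norm_exp_eq_Re)
  ultimately show ?thesis
    using exp_ge_zero[of "- \<alpha> * x\<^sup>2 + (- 2 * \<alpha>) * x"] exp_ge_zero[of "- \<alpha> * x\<^sup>2 + 0 * x"] by linarith
qed

lemma integral_unit_intervals:
  fixes G :: "real \<Rightarrow> complex"
  assumes "continuous_on UNIV G"
  shows "(\<Sum>n\<in>{- int N..<int N}. integral {0..1} (\<lambda>s. G (s + of_int n))) = integral {- real N..real N} G"
proof (induction N)
  case (Suc N)
  have cont: "continuous_on A G" for A
    using assms continuous_on_subset by blast
  have shift: "integral {0..1} (\<lambda>s. G (s + c)) = integral {c..1 + c} G" for c
    using integral_shift[of 0 c 1 G] cont by (simp add: o_def)
  have int: "G integrable_on {a..b}" for a b
    by (intro integrable_continuous_interval cont)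
  have "{- int (Suc N)..<int (Suc N)} = insert (- int (Suc N)) (insert (int N) {- int N..<int N})"
    by auto
  hence "(\<Sum>n\<in>{- int (Suc N)..<int (Suc N)}. integral {0..1} (\<lambda>s. G (s + of_int n))) =
    integral {- real (Suc N)..- real N} G + (integral {real N..real (Suc N)} G + integral {- real N..real N} G)"
    using Suc by (simp add: shift)
  also have "integral {- real N..real N} G + integral {real N..real (Suc N)} G = integral {- real N..real (Suc N)} G"
    using int by (intro Henstock_Kurzweil_Integration.integral_combine) auto
  hence "integral {real N..real (Suc N)} G + integral {- real N..real N} G = integral {- real N..real (Suc N)} G"
    by (simp only: add.commute)
  also have "integral {- real (Suc N)..- real N} G + integral {- real N..real (Suc N)} G = integral {- real (Suc N)..real (Suc N)} G"
    using int by (intro Henstock_Kurzweil_Integration.integral_combine) auto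
  finally show ?case .
qed simp

text \<open>Both sides are continuous and 1-periodic in s, so it is enough to compare Fourier
  coefficients. On the left, sum and integral unfold to a Gaussian integral over the whole line; on
  the right only the term of index - k survives.\<close>

lemma gaussian_poisson_summation:
  fixes \<alpha> \<kappa> s :: real
  assumes "\<alpha> > 0"
  shows "(\<Sum>\<^sub>\<infinity>n::int. exp (of_real (- \<alpha> * (s + of_int n)\<^sup>2) + \<i> * of_real (\<kappa> * (s + of_int n)))) =
         (\<Sum>\<^sub>\<infinity>k::int. of_real (sqrt (pi / \<alpha>) * exp (- (\<kappa> - 2 * pi * of_int k)\<^sup>2 / (4 * \<alpha>))) * exp (2 * pi * \<i> * of_int k * of_real s))"
    (is "?f s = ?g s")
proof -
  define G where "G = (\<lambda>\<kappa> s. exp (of_real (- \<alpha> * s\<^sup>2) + \<i> * of_real (\<kappa> * s)))"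
  define c where "c = (\<lambda>k::int. sqrt (pi / \<alpha>) * exp (- (\<kappa> - 2 * pi * of_int k)\<^sup>2 / (4 * \<alpha>)))"
  define M where "M = (\<lambda>n::int. exp (- \<alpha> * (of_int n)\<^sup>2 + (- 2 * \<alpha>) * of_int n) + exp (- \<alpha> * (of_int n)\<^sup>2 + 0 * of_int n))"
  have M: "M summable_on UNIV"
    unfolding M_def by (intro summable_on_add gaussian_int_summable assms)
  have G_bound: "norm (G \<kappa> (s + of_int n)) \<le> M n" if "s \<in> {0..1}" for \<kappa> s n
    unfolding G_def M_def using assms that by (rule gaussian_norm_bound)
  have G_cont: "continuous_on A (G \<kappa>)" for \<kappa> A
    unfolding G_def by (intro continuous_intros)
  have G_cont': "continuous_on A (\<lambda>s. G \<kappa> (s + of_int n))" for \<kappa> A n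
    unfolding G_def by (intro continuous_intros)
  have c_sum: "c summable_on UNIV"
  proof -
    have c_eq: "c = (\<lambda>n. sqrt (pi / \<alpha>) * exp (- \<kappa>\<^sup>2 / (4 * \<alpha>)) * exp (- (pi\<^sup>2 / \<alpha>) * (of_int n)\<^sup>2 + (pi * \<kappa> / \<alpha>) * of_int n))"
    proof
      fix n
      have "- (\<kappa> - 2 * pi * of_int n)\<^sup>2 / (4 * \<alpha>) = - \<kappa>\<^sup>2 / (4 * \<alpha>) + (- (pi\<^sup>2 / \<alpha>) * (of_int n)\<^sup>2 + (pi * \<kappa> / \<alpha>) * of_int n)"
        using assms by (simp add: power2_eq_square field_simps)
      thus "c n = sqrt (pi / \<alpha>) * exp (- \<kappa>\<^sup>2 / (4 * \<alpha>)) * exp (- (pi\<^sup>2 / \<alpha>) * (of_int n)\<^sup>2 + (pi * \<kappa> / \<alpha>) * of_int n)"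
        unfolding c_def by (simp only: exp_add mult.assoc)
    qed
    show ?thesis unfolding c_eq
      using assms by (intro summable_on_cmult_right gaussian_int_summable) simp
  qed
  have e_norm: "norm (exp (2 * pi * \<i> * of_int k * of_real s)) = 1" for k s
    by (simp add: norm_exp_eq_Re)
  define D where "D = (\<lambda>s. ?f s - ?g s)"
  have f_shift: "?f (s + of_int j) = ?f s" for s j
    by (rule infsum_reindex_bij_witness[of _ "\<lambda>n. n - j" "\<lambda>n. n + j"]) (auto simp: add_ac)
  have g_shift: "?g (s + of_int j) = ?g s" for s j
  proof (rule infsum_cong)
    fix k :: int
    have "exp (2 * pi * \<i> * of_int k * of_real (s + of_int j)) = exp (2 * pi * \<i> * of_int k * of_real s) * exp ((2 * of_int (k * j) * pi) * \<i>)"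
      by (simp add: algebra_simps flip: exp_add)
    thus "of_real (sqrt (pi / \<alpha>) * exp (- (\<kappa> - 2 * pi * of_int k)\<^sup>2 / (4 * \<alpha>))) * exp (2 * pi * \<i> * of_int k * of_real (s + of_int j)) =
       of_real (sqrt (pi / \<alpha>) * exp (- (\<kappa> - 2 * pi * of_int k)\<^sup>2 / (4 * \<alpha>))) * exp (2 * pi * \<i> * of_int k * of_real s)"
      by (simp only: exp_integer_2pi[OF Ints_of_int] mult_1_right)
  qed
  have D_shift: "D (s + of_int j) = D s" for s j
    unfolding D_def f_shift g_shift ..
  have f_cont: "continuous_on {0..1} ?f"
    using integral_infsum_uniform(1)[OF G_cont' G_bound M] unfolding G_def .
  have g_bound: "norm (of_real (c k) * exp (2 * pi * \<i> * of_int k * of_real s)) \<le> c k" for k s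
    using assms by (simp add: norm_mult e_norm c_def)
  have "continuous_on {0..1} (\<lambda>s. \<Sum>\<^sub>\<infinity>k. of_real (c k) * exp (2 * pi * \<i> * of_int k * of_real s))"
    by (rule integral_infsum_uniform(1)[OF _ g_bound c_sum]) (intro continuous_intros)
  hence g_cont: "continuous_on {0..1} ?g" unfolding c_def .
  have f_coeff: "integral {0..1} (\<lambda>s. ?f s * exp (2 * pi * \<i> * of_int k * of_real s)) = of_real (c (- k))" for k
  proof -
    \<comment> \<open>The factor exp (2 pi i k s) takes the same value at s + n, so it can be
      absorbed into each term, where it merely shifts the frequency.\<close>
    define \<kappa>' where "\<kappa>' = \<kappa> + 2 * pi * of_int k"
    have "?f s * exp (2 * pi * \<i> * of_int k * of_real s) = (\<Sum>\<^sub>\<infinity>n. G \<kappa>' (s + of_int n))" for s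
      unfolding infsum_cmult_left'[symmetric]
    proof (rule infsum_cong)
      fix n :: int
      have "G \<kappa>' (s + of_int n) = G \<kappa> (s + of_int n) * exp (2 * pi * \<i> * of_int k * of_real s) * exp ((2 * of_int (k * n) * pi) * \<i>)"
        by (simp add: G_def \<kappa>'_def algebra_simps flip: exp_add)
      thus "exp (of_real (- \<alpha> * (s + of_int n)\<^sup>2) + \<i> * of_real (\<kappa> * (s + of_int n))) * exp (2 * pi * \<i> * of_int k * of_real s) = G \<kappa>' (s + of_int n)"
        unfolding exp_integer_2pi[OF Ints_of_int] by (simp add: G_def)
    qed
    moreover have "integral {0..1} (\<lambda>s. \<Sum>\<^sub>\<infinity>n. G \<kappa>' (s + of_int n)) = of_real (c (- k))"
    proof (rule LIMSEQ_unique)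
      have "((\<lambda>n. integral {0..1} (\<lambda>s. G \<kappa>' (s + of_int n))) has_sum integral {0..1} (\<lambda>s. \<Sum>\<^sub>\<infinity>n. G \<kappa>' (s + of_int n))) UNIV"
        by (rule integral_infsum_uniform(2)[OF G_cont' G_bound M])
      hence "(\<lambda>N. \<Sum>n\<in>{- int N..<int N}. integral {0..1} (\<lambda>s. G \<kappa>' (s + of_int n))) \<longlonglongrightarrow> integral {0..1} (\<lambda>s. \<Sum>\<^sub>\<infinity>n. G \<kappa>' (s + of_int n))"
        unfolding has_sum_def by (rule filterlim_compose[OF _ filterlim_int_intervals])
      also have "(\<lambda>N. \<Sum>n\<in>{- int N..<int N}. integral {0..1} (\<lambda>s. G \<kappa>' (s + of_int n))) = (\<lambda>N. integral {- real N..real N} (G \<kappa>'))"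
        by (intro ext integral_unit_intervals[OF G_cont])
      finally show "(\<lambda>N. integral {- real N..real N} (G \<kappa>')) \<longlonglongrightarrow> integral {0..1} (\<lambda>s. \<Sum>\<^sub>\<infinity>n. G \<kappa>' (s + of_int n))" .
      show "(\<lambda>N. integral {- real N..real N} (G \<kappa>')) \<longlonglongrightarrow> of_real (c (- k))"
      proof -
        have bi: "has_bochner_integral lborel (G \<kappa>') (of_real (sqrt (pi / \<alpha>) * exp (- \<kappa>'\<^sup>2 / (4 * \<alpha>))))"
          unfolding G_def by (rule gaussian_fourier_integral[OF assms])
        hence int: "integrable lborel (G \<kappa>')" by (simp add: has_bochner_integral_iff)
        have U: "(\<Union>N. {- real N..real N}) = UNIV"
        proof (intro equalityI subsetI)
          fix x :: real
          obtain N where "\<bar>x\<bar> \<le> real N" using real_arch_simple by blast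
          thus "x \<in> (\<Union>N. {- real N..real N})" by (intro UN_I[of N]) auto
        qed auto
        have "(\<lambda>N. LINT x:{- real N..real N}|lborel. G \<kappa>' x) \<longlonglongrightarrow> (LINT x:(\<Union>N. {- real N..real N})|lborel. G \<kappa>' x)"
          by (rule set_integral_cont_up) (use int in \<open>auto simp: U incseq_def set_integrable_def\<close>)
        also have "(LINT x:(\<Union>N. {- real N..real N})|lborel. G \<kappa>' x) = of_real (c (- k))"
          using bi unfolding U by (simp add: set_lebesgue_integral_def has_bochner_integral_iff c_def \<kappa>'_def)
        finally show ?thesis
        proof (rule back_subst[of "\<lambda>f. f \<longlonglongrightarrow> _"])
          have "set_integrable lborel {- real N..real N} (G \<kappa>')" for N
            using int unfolding set_integrable_def by (intro integrable_mult_indicator) auto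
          thus "(\<lambda>N. LINT x:{- real N..real N}|lborel. G \<kappa>' x) = (\<lambda>N. integral {- real N..real N} (G \<kappa>'))"
            by (intro ext set_borel_integral_eq_integral(2))
        qed
      qed
    qed
    ultimately show ?thesis by (simp only:)
  qed
  have g_coeff: "integral {0..1} (\<lambda>s. ?g s * exp (2 * pi * \<i> * of_int k * of_real s)) = of_real (c (- k))" for k
  proof -
    have "?g s * exp (2 * pi * \<i> * of_int k * of_real s) = (\<Sum>\<^sub>\<infinity>j. of_real (c j) * exp (2 * pi * \<i> * of_int (j + k) * of_real s))" for s
      unfolding infsum_cmult_left'[symmetric]
      by (intro infsum_cong) (simp add: c_def algebra_simps flip: exp_add)
    moreover have "integral {0..1} (\<lambda>s. \<Sum>\<^sub>\<infinity>j. of_real (c j) * exp (2 * pi * \<i> * of_int (j + k) * of_real s)) = of_real (c (- k))"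
    proof (rule has_sum_unique)
      show "((\<lambda>j. integral {0..1} (\<lambda>s. of_real (c j) * exp (2 * pi * \<i> * of_int (j + k) * of_real s)))
         has_sum integral {0..1} (\<lambda>s. \<Sum>\<^sub>\<infinity>j. of_real (c j) * exp (2 * pi * \<i> * of_int (j + k) * of_real s))) UNIV"
      proof (rule integral_infsum_uniform(2)[OF _ _ c_sum])
        show "norm (of_real (c n) * exp (2 * pi * \<i> * of_int (n + k) * of_real s)) \<le> c n" for n s
          using g_bound[of n s] unfolding norm_mult e_norm .
      qed (auto intro!: continuous_intros)
      show "((\<lambda>j. integral {0..1} (\<lambda>s. of_real (c j) * exp (2 * pi * \<i> * of_int (j + k) * of_real s))) has_sum of_real (c (- k))) UNIV"
      proof (rule has_sum_finite_neutralI[of "{- k}"])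
        show "integral {0..1} (\<lambda>s. of_real (c j) * exp (2 * pi * \<i> * of_int (j + k) * of_real s)) = 0" if "j \<in> UNIV - {- k}" for j
          using that integral_exp_int[of "j + k"] by simp
        show "of_real (c (- k)) = (\<Sum>j\<in>{- k}. integral {0..1} (\<lambda>s. of_real (c j) * exp (2 * pi * \<i> * of_int (j + k) * of_real s)))"
          by simp
      qed auto
    qed
    ultimately show ?thesis by (simp only:)
  qed
  have D0: "D s = 0" if "s \<in> {0..1}" for s
  proof (rule fourier_uniqueness[OF _ _ _ that])
    show "continuous_on {0..1} D" unfolding D_def by (intro continuous_intros f_cont g_cont)
    show "D 0 = D 1" using D_shift[of 0 1] by simp
    fix k :: int
    have "(\<lambda>s. ?f s * exp (2 * pi * \<i> * of_int k * of_real s)) integrable_on {0..1}"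
      by (intro integrable_continuous_interval continuous_on_mult f_cont) (intro continuous_intros)
    moreover have "(\<lambda>s. ?g s * exp (2 * pi * \<i> * of_int k * of_real s)) integrable_on {0..1}"
      by (intro integrable_continuous_interval continuous_on_mult g_cont) (intro continuous_intros)
    ultimately have "integral {0..1} (\<lambda>s. ?f s * exp (2 * pi * \<i> * of_int k * of_real s) - ?g s * exp (2 * pi * \<i> * of_int k * of_real s)) = of_real (c (- k)) - of_real (c (- k))"
      by (subst Henstock_Kurzweil_Integration.integral_diff) (simp_all only: f_coeff g_coeff)
    thus "integral {0..1} (\<lambda>s. D s * exp (2 * pi * \<i> * of_int k * of_real s)) = 0"
      by (simp add: D_def left_diff_distrib)
  qed
  have "D s = D (frac s + of_int \<lfloor>s\<rfloor>)" by (simp add: frac_def)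
  also have "\<dots> = 0" unfolding D_shift by (rule D0) (simp add: frac_ge_0 frac_lt_1 less_imp_le)
  finally show ?thesis by (simp add: D_def)
qed

section \<open>The sum over a row of the lattice\<close>

lemma gaussian_int_summable':
  fixes a b d :: real
  assumes "a > 0" and q: "\<And>n. q n = - a * (of_int n)\<^sup>2 + b * of_int n + d"
  shows "(\<lambda>n::int. exp (q n)) summable_on UNIV"
  unfolding q exp_add[of _ d] by (intro summable_on_cmult_left gaussian_int_summable assms)

lemma neg_one_powi_eq_exp: "(-1 :: complex) powi n = exp (\<i> * of_real pi * of_int n)"
proof -
  have "(-1 :: complex) powi n = exp (\<i> * of_real pi) powi n" by (simp add: mult.commute)
  thus ?thesis unfolding exp_power_int by (simp add: mult_ac)
qed

text \<open>A simple pole times a Gaussian of modulus exp (- c (Re w)^2 / 2 - 3 c (Im w)^2 / 2). Up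
  to signs and factors depending only on u and m, the terms of the lattice sum are its values at w =
  u + \<lambda>; see \<open>appell_sum_term_eq_kernel\<close>.\<close>

definition appell_kernel :: "real \<Rightarrow> complex \<Rightarrow> complex" where
  "appell_kernel c w = exp (of_real c * (w\<^sup>2 / 2 - w * cnj w)) / w"

text \<open>
  The frequencies \<open>r\<close> of a row lie in \<open>\<int> + l / 2\<close> and are indexed by the integer \<open>k = r + l / 2\<close>.
\<close>

definition erf_arg :: "nat \<Rightarrow> real \<Rightarrow> real \<Rightarrow> int \<Rightarrow> real" where
  "erf_arg l y \<eta> k = (\<eta> / y - (of_int k - of_nat l / 2) / of_nat l) * sqrt (2 * of_nat l * y)"

text \<open>
  Multiplying by \<open>1 - exp (2 * pi * \<i> * w)\<close> turns each \<open>1 / (w + n)\<close> into the integral of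
  \<open>exp (\<i> * \<sigma> * (w + n))\<close> over a period, after which the sum over \<open>n\<close> is a Gaussian theta series.
\<close>

lemma appell_kernel_sum:
  fixes l :: nat and y :: real and w :: complex
  assumes l: "l > 0" and y: "y > 0" and w: "\<And>n::int. w + of_int n \<noteq> 0"
  defines "c \<equiv> pi * of_nat l / y"
  shows "(1 - exp (2 * of_real pi * \<i> * w)) * (\<Sum>\<^sub>\<infinity>n::int. (-1) powi (int l * n) * appell_kernel c (w + of_int n)) =
    - (of_real pi * \<i>) * (\<Sum>\<^sub>\<infinity>k::int. exp (2 * of_real pi * \<i> * (of_int k - of_nat l / 2) * w) *
        of_real (zwegers_E (erf_arg l y (Im w) (k - 1)) - zwegers_E (erf_arg l y (Im w) k)))"
proof -
  define \<alpha> where "\<alpha> = c / 2"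
  define s where "s = Re w"
  define \<eta> where "\<eta> = Im w"
  have w_eq: "w = of_real s + \<i> * of_real \<eta>" by (simp add: s_def \<eta>_def complex_eq_iff)
  have \<alpha>: "\<alpha> > 0" using l y by (simp add: \<alpha>_def c_def)
  define f where "f = (\<lambda>(n::int) \<sigma>. (-1) powi (int l * n) * exp (of_real c * ((w + of_int n)\<^sup>2 / 2 - (w + of_int n) * cnj (w + of_int n))) * exp (\<i> * of_real \<sigma> * (w + of_int n)))"
  define g where "g = (\<lambda>(k::int) \<sigma>. exp (2 * of_real pi * \<i> * (of_int k - of_nat l / 2) * w) * of_real (sqrt (pi / \<alpha>) * exp (- (\<sigma> - 2 * pi * (of_int k - of_nat l / 2) + 4 * \<alpha> * \<eta>)\<^sup>2 / (4 * \<alpha>))))"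
  \<comment> \<open>(-1)^(l n) is exp (pi i l (s + n)) times exp (- pi i l s). The first factor goes
    into the frequency and causes the offset l / 2 of the dual variable, the second goes into
    \<open>C\<close>. The summand 2 \<alpha> \<eta> is the cross term of (w + n)^2.\<close>
  define \<kappa> where "\<kappa> = (\<lambda>\<sigma>. \<sigma> + pi * of_nat l + 2 * \<alpha> * \<eta>)"
  define C where "C = (\<lambda>\<sigma>. exp (of_real (- 3 * \<alpha> * \<eta>\<^sup>2 - \<sigma> * \<eta>) - \<i> * of_real (pi * of_nat l * s)))"
  have f_eq: "f n \<sigma> = C \<sigma> * exp (of_real (- \<alpha> * (s + of_int n)\<^sup>2) + \<i> * of_real (\<kappa> \<sigma> * (s + of_int n)))" for n \<sigma>
    unfolding f_def C_def neg_one_powi_eq_exp exp_add[symmetric]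
    by (rule arg_cong[of _ _ exp])
       (simp add: complex_eq_iff w_eq \<kappa>_def \<alpha>_def power2_eq_square field_simps)
  have C_g: "C \<sigma> * (of_real (sqrt (pi / \<alpha>) * exp (- (\<kappa> \<sigma> - 2 * pi * of_int k)\<^sup>2 / (4 * \<alpha>))) * exp (2 * pi * \<i> * of_int k * of_real s)) = g k \<sigma>" for k \<sigma>
  proof -
    have real: "- 3 * \<alpha> * \<eta>\<^sup>2 - \<sigma> * \<eta> + - (\<kappa> \<sigma> - 2 * pi * of_int k)\<^sup>2 / (4 * \<alpha>)
        = - 2 * pi * (of_int k - of_nat l / 2) * \<eta> + - (\<sigma> - 2 * pi * (of_int k - of_nat l / 2) + 4 * \<alpha> * \<eta>)\<^sup>2 / (4 * \<alpha>)"
      using \<alpha> by (simp add: \<kappa>_def power2_eq_square field_simps)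
    have "C \<sigma> * (of_real (exp (- (\<kappa> \<sigma> - 2 * pi * of_int k)\<^sup>2 / (4 * \<alpha>))) * exp (2 * pi * \<i> * of_int k * of_real s)) =
      exp (of_real (- 3 * \<alpha> * \<eta>\<^sup>2 - \<sigma> * \<eta> + - (\<kappa> \<sigma> - 2 * pi * of_int k)\<^sup>2 / (4 * \<alpha>)) + \<i> * of_real (2 * pi * (of_int k - of_nat l / 2) * s))"
      unfolding C_def exp_of_real[symmetric] exp_add[symmetric]
      by (rule arg_cong[of _ _ exp]) (simp add: algebra_simps)
    also have "\<dots> = exp (2 * of_real pi * \<i> * (of_int k - of_nat l / 2) * w) * of_real (exp (- (\<sigma> - 2 * pi * (of_int k - of_nat l / 2) + 4 * \<alpha> * \<eta>)\<^sup>2 / (4 * \<alpha>)))"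
      unfolding real exp_of_real[symmetric] exp_add[symmetric]
      by (rule arg_cong[of _ _ exp]) (simp add: w_eq algebra_simps)
    finally show ?thesis
      by (simp add: g_def mult_ac)
  qed
  have f_sum_g_sum: "(\<Sum>\<^sub>\<infinity>n. f n \<sigma>) = (\<Sum>\<^sub>\<infinity>k. g k \<sigma>)" for \<sigma>
    unfolding f_eq infsum_cmult_right' gaussian_poisson_summation[OF \<alpha>]
    unfolding infsum_cmult_right'[symmetric] C_g ..

  define Mf where "Mf = (\<lambda>n::int. exp (2 * pi * \<bar>\<eta>\<bar>) * exp (- \<alpha> * (s + of_int n)\<^sup>2))"
  have "(\<lambda>n::int. exp (- \<alpha> * (s + of_int n)\<^sup>2)) summable_on UNIV"
    by (rule gaussian_int_summable'[of \<alpha> _ "- 2 * \<alpha> * s" "- \<alpha> * s\<^sup>2"]) (use \<alpha> in \<open>auto simp: power2_eq_square algebra_simps\<close>)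
  hence Mf: "Mf summable_on UNIV" unfolding Mf_def by (rule summable_on_cmult_right)
  have f_bound: "norm (f n \<sigma>) \<le> Mf n" if "\<sigma> \<in> {0..2*pi}" for n \<sigma>
  proof -
    have "- \<sigma> * \<eta> \<le> \<bar>\<sigma> * \<eta>\<bar>" by (simp add: abs_le_iff)
    also have "\<bar>\<sigma> * \<eta>\<bar> \<le> 2 * pi * \<bar>\<eta>\<bar>" using that by (simp add: abs_mult mult_right_mono)
    finally have "- \<sigma> * \<eta> \<le> 2 * pi * \<bar>\<eta>\<bar>" .
    moreover have "0 \<le> 3 * \<alpha> * \<eta>\<^sup>2" using \<alpha> by simp
    ultimately have "- 3 * \<alpha> * \<eta>\<^sup>2 - \<sigma> * \<eta> \<le> 2 * pi * \<bar>\<eta>\<bar>" by simp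
    thus ?thesis unfolding f_eq Mf_def C_def norm_mult
      by (intro mult_mono) (simp_all add: norm_exp_eq_Re)
  qed
  have f_cont: "continuous_on A (f n)" for A n unfolding f_def by (intro continuous_intros)
  have e1: "exp (2 * of_real pi * \<i> * (w + of_int n)) = exp (2 * of_real pi * \<i> * w)" for n
    using exp_integer_2pi[of "of_int n"] by (simp add: distrib_left exp_add mult_ac)
  \<comment> \<open>exp (2 pi i W) does not depend on the integer n, so every period integral yields
    the same factor 1 - exp (2 pi i w).\<close>
  have f_int: "integral {0..2*pi} (f n) = \<i> * (1 - exp (2 * of_real pi * \<i> * w)) * ((-1) powi (int l * n) * appell_kernel c (w + of_int n))" for n
  proof -
    define W where "W = w + of_int n"
    define K where "K = (-1) powi (int l * n) * exp (of_real c * (W\<^sup>2 / 2 - W * cnj W))"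
    have W: "W \<noteq> 0" using w by (simp add: W_def)
    have "((\<lambda>z. K * exp (\<i> * z * W) / (\<i> * W)) has_field_derivative K * exp (\<i> * z * W)) (at z)" for z
      using W by (auto intro!: derivative_eq_intros)
    hence "((\<lambda>\<sigma>. K * exp (\<i> * of_real \<sigma> * W)) has_integral K * exp (\<i> * of_real (2*pi) * W) / (\<i> * W) - K * exp (\<i> * of_real 0 * W) / (\<i> * W)) {0..2*pi}"
      by (intro fundamental_theorem_of_calculus has_vector_derivative_real_field) auto
    moreover have "(\<lambda>\<sigma>. K * exp (\<i> * of_real \<sigma> * W)) = f n"
      by (simp add: f_def K_def W_def)
    moreover have "exp (\<i> * of_real (2*pi) * W) = exp (2 * of_real pi * \<i> * w)"
      unfolding W_def e1[of n, symmetric] by (simp add: mult_ac)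
    ultimately have "(f n has_integral K * exp (2 * of_real pi * \<i> * w) / (\<i> * W) - K * exp (\<i> * of_real 0 * W) / (\<i> * W)) {0..2*pi}"
      by (simp only:)
    hence "integral {0..2*pi} (f n) = K * exp (2 * of_real pi * \<i> * w) / (\<i> * W) - K * exp (\<i> * of_real 0 * W) / (\<i> * W)"
      by (rule integral_unique)
    also have "\<dots> = \<i> * (1 - exp (2 * of_real pi * \<i> * w)) * (K / W)"
      using W by (simp add: divide_simps) (simp add: algebra_simps)
    also have "K / W = (-1) powi (int l * n) * appell_kernel c W"
      by (simp add: K_def appell_kernel_def)
    finally show ?thesis unfolding W_def .
  qed

  \<comment> \<open>The period 2 pi is taken as the unit: \<sigma> / (2 pi) lies in [0, 1], and
    \<open>gaussian_norm_bound\<close> applies with x = B - k.\<close>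
  define \<alpha>' where "\<alpha>' = pi\<^sup>2 / \<alpha>"
  define B where "B = (pi * of_nat l + 4 * \<alpha> * \<eta>) / (2 * pi)"
  define Mg where "Mg = (\<lambda>k::int. exp (- 2 * pi * \<eta> * (of_int k - of_nat l / 2)) * sqrt (pi / \<alpha>) *
     (exp (- \<alpha>' * (B - of_int k)\<^sup>2 + (- 2 * \<alpha>') * (B - of_int k)) + exp (- \<alpha>' * (B - of_int k)\<^sup>2 + 0 * (B - of_int k))))"
  have \<alpha>': "\<alpha>' > 0" using \<alpha> by (simp add: \<alpha>'_def)
  have Mg: "Mg summable_on UNIV"
  proof -
    have "(\<lambda>k::int. exp (- 2 * pi * \<eta> * (of_int k - of_nat l / 2) + (- \<alpha>' * (B - of_int k)\<^sup>2 + (- 2 * \<alpha>') * (B - of_int k)))) summable_on UNIV"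
      by (rule gaussian_int_summable'[of \<alpha>' _ "- 2 * pi * \<eta> + 2 * \<alpha>' * B + 2 * \<alpha>'" "pi * \<eta> * of_nat l - \<alpha>' * B\<^sup>2 - 2 * \<alpha>' * B"])
         (use \<alpha>' in \<open>auto simp: power2_eq_square algebra_simps\<close>)
    moreover have "(\<lambda>k::int. exp (- 2 * pi * \<eta> * (of_int k - of_nat l / 2) + (- \<alpha>' * (B - of_int k)\<^sup>2 + 0 * (B - of_int k)))) summable_on UNIV"
      by (rule gaussian_int_summable'[of \<alpha>' _ "- 2 * pi * \<eta> + 2 * \<alpha>' * B" "pi * \<eta> * of_nat l - \<alpha>' * B\<^sup>2"])
         (use \<alpha>' in \<open>auto simp: power2_eq_square algebra_simps\<close>)
    ultimately have "(\<lambda>k::int. sqrt (pi / \<alpha>) * (exp (- 2 * pi * \<eta> * (of_int k - of_nat l / 2) + (- \<alpha>' * (B - of_int k)\<^sup>2 + (- 2 * \<alpha>') * (B - of_int k))) +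
        exp (- 2 * pi * \<eta> * (of_int k - of_nat l / 2) + (- \<alpha>' * (B - of_int k)\<^sup>2 + 0 * (B - of_int k))))) summable_on UNIV"
      by (intro summable_on_cmult_right summable_on_add)
    thus ?thesis unfolding Mg_def exp_add distrib_left by (simp only: mult_ac)
  qed
  have g_bound: "norm (g k \<sigma>) \<le> Mg k" if "\<sigma> \<in> {0..2*pi}" for k \<sigma>
  proof -
    have "- (\<sigma> - 2 * pi * (of_int k - of_nat l / 2) + 4 * \<alpha> * \<eta>)\<^sup>2 / (4 * \<alpha>) = - \<alpha>' * (\<sigma> / (2 * pi) + (B - of_int k))\<^sup>2"
      using \<alpha> by (simp add: \<alpha>'_def B_def power2_eq_square field_simps)
    moreover have "norm (exp (of_real (- \<alpha>' * (\<sigma> / (2 * pi) + (B - of_int k))\<^sup>2) + \<i> * of_real 0)) \<le>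
       exp (- \<alpha>' * (B - of_int k)\<^sup>2 + (- 2 * \<alpha>') * (B - of_int k)) + exp (- \<alpha>' * (B - of_int k)\<^sup>2 + 0 * (B - of_int k))"
      by (rule gaussian_norm_bound) (use \<alpha>' that in \<open>auto simp: divide_simps\<close>)
    ultimately have le: "exp (- (\<sigma> - 2 * pi * (of_int k - of_nat l / 2) + 4 * \<alpha> * \<eta>)\<^sup>2 / (4 * \<alpha>)) \<le>
       exp (- \<alpha>' * (B - of_int k)\<^sup>2 + (- 2 * \<alpha>') * (B - of_int k)) + exp (- \<alpha>' * (B - of_int k)\<^sup>2 + 0 * (B - of_int k))"
      by (simp add: norm_exp_eq_Re)
    have N: "norm (exp (2 * of_real pi * \<i> * (of_int k - of_nat l / 2) * w)) = exp (- 2 * pi * \<eta> * (of_int k - of_nat l / 2))"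
      by (simp add: norm_exp_eq_Re w_eq algebra_simps)
    have "norm (g k \<sigma>) = exp (- 2 * pi * \<eta> * (of_int k - of_nat l / 2)) * sqrt (pi / \<alpha>) *
        exp (- (\<sigma> - 2 * pi * (of_int k - of_nat l / 2) + 4 * \<alpha> * \<eta>)\<^sup>2 / (4 * \<alpha>))"
      unfolding g_def norm_mult norm_of_real N using \<alpha> by (simp add: abs_mult)
    also have "\<dots> \<le> Mg k"
      unfolding Mg_def using le \<alpha> by (intro mult_left_mono) auto
    finally show ?thesis .
  qed
  have g_cont: "continuous_on A (g k)" for A k unfolding g_def using \<alpha> by (intro continuous_intros) auto
  have g_int: "integral {0..2*pi} (g k) = of_real pi * (exp (2 * of_real pi * \<i> * (of_int k - of_nat l / 2) * w) *
        of_real (zwegers_E (erf_arg l y \<eta> (k - 1)) - zwegers_E (erf_arg l y \<eta> k)))" for k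
  proof -
    define b where "b = - 2 * pi * (of_int k - of_nat l / 2) + 4 * \<alpha> * \<eta>"
    have gk: "g k = (\<lambda>\<sigma>. exp (2 * of_real pi * \<i> * (of_int k - of_nat l / 2) * w) * of_real (sqrt (pi / \<alpha>)) * of_real (exp (- (\<sigma> + b)\<^sup>2 / (4 * \<alpha>))))"
    proof
      fix \<sigma>
      have "\<sigma> - 2 * pi * (of_int k - of_nat l / 2) + 4 * \<alpha> * \<eta> = \<sigma> + b" by (simp add: b_def)
      thus "g k \<sigma> = exp (2 * of_real pi * \<i> * (of_int k - of_nat l / 2) * w) * of_real (sqrt (pi / \<alpha>)) * of_real (exp (- (\<sigma> + b)\<^sup>2 / (4 * \<alpha>)))"
        unfolding g_def by (simp only: of_real_mult mult.assoc)
    qed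
    \<comment> \<open>This scale turns the Gaussian of \<open>g k\<close> into exp (- pi t^2), the
      integrand of E. Raising \<sigma> by 2 pi amounts to lowering k by 1, so the endpoints of the
      period give \<open>erf_arg\<close> at k and at k - 1.\<close>
    define d where "d = sqrt (4 * pi * \<alpha>)"
    have d: "d > 0" "d\<^sup>2 = 4 * pi * \<alpha>" using \<alpha> by (auto simp: d_def)
    have "((\<lambda>\<sigma>. d / 2 * zwegers_E ((\<sigma> + b) / d)) has_real_derivative exp (- (\<sigma> + b)\<^sup>2 / (4 * \<alpha>))) (at \<sigma>)" for \<sigma>
    proof -
      have "((\<lambda>\<sigma>. d / 2 * zwegers_E ((\<sigma> + b) / d)) has_real_derivative d / 2 * (2 * exp (- pi * ((\<sigma> + b) / d)\<^sup>2) * (1 / d))) (at \<sigma>)"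
        using d by (intro DERIV_cmult DERIV_chain2[OF zwegers_E_has_real_derivative]) (auto intro!: derivative_eq_intros)
      moreover have "- pi * ((\<sigma> + b) / d)\<^sup>2 = - (\<sigma> + b)\<^sup>2 / (4 * \<alpha>)"
        using d by (simp add: power_divide)
      ultimately show ?thesis using d by simp
    qed
    hence "((\<lambda>\<sigma>. exp (- (\<sigma> + b)\<^sup>2 / (4 * \<alpha>))) has_integral d / 2 * zwegers_E ((2 * pi + b) / d) - d / 2 * zwegers_E ((0 + b) / d)) {0..2*pi}"
      by (intro fundamental_theorem_of_calculus) (auto simp: has_real_derivative_iff_has_vector_derivative[symmetric] has_field_derivative_at_within)
    from has_integral_mult_right[OF has_integral_of_real[OF this], of "exp (2 * of_real pi * \<i> * (of_int k - of_nat l / 2) * w) * of_real (sqrt (pi / \<alpha>))"]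
    have "(g k has_integral exp (2 * of_real pi * \<i> * (of_int k - of_nat l / 2) * w) * of_real (sqrt (pi / \<alpha>)) *
       of_real (d / 2 * zwegers_E ((2 * pi + b) / d) - d / 2 * zwegers_E ((0 + b) / d))) {0..2*pi}"
      unfolding gk .
    moreover have "(2 * pi + b) / d = erf_arg l y \<eta> (k - 1)" "(0 + b) / d = erf_arg l y \<eta> k"
    proof -
      have "d = sqrt ((pi / y)\<^sup>2 * (2 * of_nat l * y))"
        using y by (simp add: d_def \<alpha>_def c_def power2_eq_square)
      hence d_eq: "d = pi / y * sqrt (2 * of_nat l * y)"
        using y by (simp only: real_sqrt_mult real_sqrt_abs) simp
      have "sqrt (2 * of_nat l * y) * sqrt (2 * of_nat l * y) = 2 * of_nat l * y"
        using y by simp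
      thus "(2 * pi + b) / d = erf_arg l y \<eta> (k - 1)" "(0 + b) / d = erf_arg l y \<eta> k"
        using y l unfolding d_eq b_def erf_arg_def \<alpha>_def c_def
        by (simp_all add: field_simps)
    qed
    moreover have "sqrt (pi / \<alpha>) * (d / 2) = pi"
    proof -
      have "sqrt (pi / \<alpha>) * d = sqrt ((2 * pi)\<^sup>2)"
        unfolding d_def real_sqrt_mult[symmetric] using \<alpha> by (simp add: power2_eq_square)
      hence "sqrt (pi / \<alpha>) * d = 2 * pi" unfolding real_sqrt_abs by simp
      thus ?thesis by simp
    qed
    hence "sqrt (pi / \<alpha>) * (d / 2 * X - d / 2 * Y) = pi * (X - Y)" for X Y
      by (simp add: right_diff_distrib mult.assoc[symmetric])
    ultimately have "(g k has_integral exp (2 * of_real pi * \<i> * (of_int k - of_nat l / 2) * w) *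
       of_real (pi * (zwegers_E (erf_arg l y \<eta> (k - 1)) - zwegers_E (erf_arg l y \<eta> k)))) {0..2*pi}"
      by (simp only: mult.assoc of_real_mult[symmetric])
    thus ?thesis by (simp add: integral_unique mult_ac)
  qed

  have "\<i> * (1 - exp (2 * of_real pi * \<i> * w)) * (\<Sum>\<^sub>\<infinity>n::int. (-1) powi (int l * n) * appell_kernel c (w + of_int n)) = (\<Sum>\<^sub>\<infinity>n. integral {0..2*pi} (f n))"
    unfolding f_int infsum_cmult_right' ..
  also have "\<dots> = integral {0..2*pi} (\<lambda>\<sigma>. \<Sum>\<^sub>\<infinity>n. f n \<sigma>)"
    using integral_infsum_uniform(2)[OF f_cont f_bound Mf] by (rule infsumI)
  also have "\<dots> = integral {0..2*pi} (\<lambda>\<sigma>. \<Sum>\<^sub>\<infinity>k. g k \<sigma>)"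
    unfolding f_sum_g_sum ..
  also have "\<dots> = (\<Sum>\<^sub>\<infinity>k. integral {0..2*pi} (g k))"
    using integral_infsum_uniform(2)[OF g_cont g_bound Mg] by (rule infsumI[symmetric])
  finally have "\<i> * (1 - exp (2 * of_real pi * \<i> * w)) * (\<Sum>\<^sub>\<infinity>n::int. (-1) powi (int l * n) * appell_kernel c (w + of_int n)) =
     of_real pi * (\<Sum>\<^sub>\<infinity>k::int. exp (2 * of_real pi * \<i> * (of_int k - of_nat l / 2) * w) *
        of_real (zwegers_E (erf_arg l y \<eta> (k - 1)) - zwegers_E (erf_arg l y \<eta> k)))"
    unfolding g_int infsum_cmult_right' .
  from arg_cong[OF this, of "\<lambda>z. - \<i> * z"] show ?thesis
    unfolding \<eta>_def by (simp add: mult.assoc[symmetric])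
qed

section \<open>Convergence of theta and lattice sums\<close>

lemma has_sum_product:
  fixes f :: "'i \<Rightarrow> complex" and g :: "'j \<Rightarrow> complex"
  assumes f: "(\<lambda>x. norm (f x)) summable_on A" and g: "(\<lambda>y. norm (g y)) summable_on B"
  shows "((\<lambda>(x, y). f x * g y) has_sum (infsum f A * infsum g B)) (A \<times> B)"
proof (rule has_sum_SigmaI)
  have "(\<lambda>p. norm (f (fst p)) * norm (g (snd p))) summable_on A \<times> B"
  proof (rule summable_on_SigmaI)
    show "((\<lambda>y. norm (f (fst (x, y))) * norm (g (snd (x, y)))) has_sum norm (f x) * infsum (\<lambda>y. norm (g y)) B) B" for x
      using g by (auto intro!: has_sum_cmult_right)
    show "(\<lambda>x. norm (f x) * infsum (\<lambda>y. norm (g y)) B) summable_on A"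
      using f by (rule summable_on_cmult_left)
  qed auto
  thus "(\<lambda>(x, y). f x * g y) summable_on A \<times> B"
    by (intro abs_summable_summable[of "\<lambda>(x, y). f x * g y"]) (simp add: norm_mult case_prod_unfold)
  show "((\<lambda>y. case (x, y) of (x, y) \<Rightarrow> f x * g y) has_sum f x * infsum g B) B" for x
    using abs_summable_summable[OF g] by (auto intro!: has_sum_cmult_right)
  show "((\<lambda>x. f x * infsum g B) has_sum infsum f A * infsum g B) A"
    using abs_summable_summable[OF f] by (auto intro!: has_sum_cmult_left)
qed

lemma zwegers_theta_terms_summable:
  assumes "Im \<tau> > 0"
  shows "(\<lambda>n::int. norm (let \<nu> = of_int n + 1/2 in
        exp (of_real pi * \<i> * \<nu>\<^sup>2 * \<tau> + 2 * of_real pi * \<i> * \<nu> * (z + 1/2)))) summable_on UNIV"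
  unfolding Let_def norm_exp_eq_Re
  by (rule gaussian_int_summable'[of "pi * Im \<tau>" _ "- pi * Im \<tau> - 2 * pi * Im z" "- pi * Im \<tau> / 4 - pi * Im z"])
     (use assms in \<open>auto simp: power2_eq_square algebra_simps\<close>)

text \<open>q^(- \<nu>^2 / 2) grows like exp (pi y \<nu>^2), but the difference of sign and E decays
  like exp (- 2 pi y (\<nu> + a)^2); a convergent Gaussian is left, with \<open>q\<close> as its
  exponent.\<close>

lemma zwegers_R_terms_summable:
  assumes "Im \<tau> > 0"
  shows "(\<lambda>n::int. norm (let \<nu> = (of_int n + 1/2 :: real) in
        of_real (sgn \<nu> - zwegers_E ((\<nu> + Im u / Im \<tau>) * sqrt (2 * Im \<tau>)))
        * (-1) powi n * q_pow (- (\<nu>\<^sup>2 / 2)) \<tau> * exp (- (2 * of_real pi * \<i> * of_real \<nu> * u)) :: complex)) summable_on UNIV"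
proof -
  define a where "a = Im u / Im \<tau>"
  define r where "r = sqrt (2 * Im \<tau>)"
  define y where "y = Im \<tau>"
  have y: "y > 0" "r > 0" "r\<^sup>2 = 2 * y" "Im u = a * y" using assms by (auto simp: r_def y_def a_def)
  define q where "q = (\<lambda>n::int. - 2 * pi * y * (of_int n + 1/2 + a)\<^sup>2 + pi * y * (of_int n + 1/2)\<^sup>2 + 2 * pi * (of_int n + 1/2) * a * y)"
  have "(\<lambda>n. exp (q n)) summable_on UNIV"
    by (rule gaussian_int_summable'[of "pi * y" _ "- pi * y - 2 * pi * y * a" "- pi * y / 4 - pi * y * a - 2 * pi * y * a\<^sup>2"])
       (use y in \<open>auto simp: q_def power2_eq_square algebra_simps\<close>)
  hence "(\<lambda>n. 2 * exp (pi * (a * r)\<^sup>2) * exp (q n)) summable_on UNIV"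
    by (rule summable_on_cmult_right)
  thus ?thesis
  proof (rule summable_on_comparison_test)
    fix n :: int
    define \<nu> where "\<nu> = real_of_int n + 1/2"
    have "\<nu> \<noteq> 0"
    proof
      assume "\<nu> = 0"
      hence "real_of_int (2 * n + 1) = 0" by (simp add: \<nu>_def)
      hence "2 * n + 1 = 0" by (simp only: of_int_eq_0_iff)
      thus False by presburger
    qed
    hence "\<bar>sgn (\<nu> * r) - zwegers_E (\<nu> * r + a * r)\<bar> \<le> 2 * exp (pi * (a * r)\<^sup>2) * exp (- pi * (\<nu> * r + a * r)\<^sup>2)"
      using y by (intro abs_sgn_minus_zwegers_E_le) auto
    also have "(\<nu> * r + a * r)\<^sup>2 = 2 * y * (\<nu> + a)\<^sup>2"
      unfolding distrib_right[symmetric] power_mult_distrib y(3) by simp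
    finally have E: "\<bar>sgn \<nu> - zwegers_E ((\<nu> + a) * r)\<bar> \<le> 2 * exp (pi * (a * r)\<^sup>2) * exp (- pi * (2 * y * (\<nu> + a)\<^sup>2))"
      using y by (simp add: sgn_mult distrib_right)
    have "norm (of_real (sgn \<nu> - zwegers_E ((\<nu> + a) * r)) * (-1) powi n * q_pow (- (\<nu>\<^sup>2 / 2)) \<tau> * exp (- (2 * of_real pi * \<i> * of_real \<nu> * u)) :: complex)
        = \<bar>sgn \<nu> - zwegers_E ((\<nu> + a) * r)\<bar> * exp (pi * y * \<nu>\<^sup>2 + 2 * pi * \<nu> * a * y)"
      unfolding norm_mult norm_of_real norm_power_int q_pow_def norm_exp_eq_Re mult.assoc exp_add[symmetric]
      using y by (simp add: y_def algebra_simps)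
    also have "\<dots> \<le> 2 * exp (pi * (a * r)\<^sup>2) * exp (- pi * (2 * y * (\<nu> + a)\<^sup>2)) * exp (pi * y * \<nu>\<^sup>2 + 2 * pi * \<nu> * a * y)"
      using E by (rule mult_right_mono) simp
    also have "\<dots> = 2 * exp (pi * (a * r)\<^sup>2) * exp (q n)"
      unfolding mult.assoc exp_add[symmetric] by (simp add: q_def \<nu>_def algebra_simps)
    finally show "norm (let \<nu> = (of_int n + 1/2 :: real) in
        of_real (sgn \<nu> - zwegers_E ((\<nu> + Im u / Im \<tau>) * sqrt (2 * Im \<tau>)))
        * (-1) powi n * q_pow (- (\<nu>\<^sup>2 / 2)) \<tau> * exp (- (2 * of_real pi * \<i> * of_real \<nu> * u)) :: complex) \<le> 2 * exp (pi * (a * r)\<^sup>2) * exp (q n)"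
      unfolding Let_def \<nu>_def a_def r_def .
  qed auto
qed

section \<open>Gaussian sums over the lattice and the distance to its points\<close>

definition lattice_pt :: "complex \<Rightarrow> int \<times> int \<Rightarrow> complex" where
  "lattice_pt \<tau> p = of_int (fst p) * \<tau> + of_int (snd p)"

lemma lattice_pt_norm_ge:
  assumes "Im \<tau> > 0"
  obtains \<kappa> where "\<kappa> > 0" "\<And>p. \<kappa> * ((of_int (fst p))\<^sup>2 + (of_int (snd p))\<^sup>2) \<le> (norm (lattice_pt \<tau> p))\<^sup>2"
proof -
  define x y where "x = Re \<tau>" and "y = Im \<tau>"
  \<comment> \<open>From n^2 \<le> 2 (m x + n)^2 + 2 (m x)^2 one gets m^2 + n^2 \<le> 2 (m x + n)^2
    + (2 x^2 + 1) / y^2 * (m y)^2; \<open>K\<close> is the sum of the two coefficients.\<close>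
  define K where "K = 2 + (2 * x\<^sup>2 + 1) / y\<^sup>2"
  have y: "y > 0" using assms by (simp add: y_def)
  have K: "K > 0" using y by (simp add: K_def add_pos_nonneg)
  have "1 / K * ((of_int (fst p))\<^sup>2 + (of_int (snd p))\<^sup>2) \<le> (norm (lattice_pt \<tau> p))\<^sup>2" for p
  proof -
    define m n :: real where "m = of_int (fst p)" and "n = of_int (snd p)"
    have N: "(norm (lattice_pt \<tau> p))\<^sup>2 = (m * x + n)\<^sup>2 + (m * y)\<^sup>2"
      by (simp add: cmod_power2 lattice_pt_def m_def n_def x_def y_def)
    have "n\<^sup>2 \<le> 2 * (m * x + n)\<^sup>2 + 2 * (m * x)\<^sup>2"
      using zero_le_power2[of "m * x + n + m * x"] by (simp add: power2_eq_square algebra_simps)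
    moreover have "(2 * x\<^sup>2 + 1) / y\<^sup>2 * (m * y)\<^sup>2 = 2 * (m * x)\<^sup>2 + m\<^sup>2"
      using y by (simp add: power2_eq_square field_simps)
    ultimately have "m\<^sup>2 + n\<^sup>2 \<le> 2 * (m * x + n)\<^sup>2 + (2 * x\<^sup>2 + 1) / y\<^sup>2 * (m * y)\<^sup>2"
      by linarith
    also have "\<dots> \<le> K * (m * x + n)\<^sup>2 + K * (m * y)\<^sup>2"
      by (intro add_mono mult_right_mono) (auto simp: K_def)
    finally show ?thesis using K unfolding N m_def[symmetric] n_def[symmetric]
      by (simp add: field_simps)
  qed
  thus ?thesis using K that[of "1 / K"] by simp
qed

text \<open>One half of the quadratic term absorbs the linear one by completing the square; the
  other half is dominated by a product of two one-dimensional Gaussians.\<close>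

lemma lattice_exp_summable:
  fixes b c :: real
  assumes "Im \<tau> > 0" and c: "c > 0"
  shows "(\<lambda>p. exp (b * norm (lattice_pt \<tau> p) - c * (norm (lattice_pt \<tau> p))\<^sup>2)) summable_on UNIV"
proof -
  obtain \<kappa> where \<kappa>: "\<kappa> > 0" "\<And>p. \<kappa> * ((of_int (fst p))\<^sup>2 + (of_int (snd p))\<^sup>2) \<le> (norm (lattice_pt \<tau> p))\<^sup>2"
    using lattice_pt_norm_ge[OF assms(1)] by blast
  define a where "a = c / 2 * \<kappa>"
  have a: "a > 0" using \<kappa> c by (simp add: a_def)
  have g: "(\<lambda>n::int. exp (- a * (of_int n)\<^sup>2)) summable_on UNIV"
    by (rule gaussian_int_summable'[of a _ 0 0]) (use a in auto)
  have "(\<lambda>p::int \<times> int. exp (- a * (of_int (fst p))\<^sup>2) * exp (- a * (of_int (snd p))\<^sup>2)) summable_on UNIV \<times> UNIV"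
  proof (rule summable_on_SigmaI)
    show "((\<lambda>n::int. exp (- a * (of_int (fst (m :: int, n)))\<^sup>2) * exp (- a * (of_int (snd (m, n)))\<^sup>2)) has_sum exp (- a * (of_int m)\<^sup>2) * infsum (\<lambda>n::int. exp (- a * (of_int n)\<^sup>2)) UNIV) UNIV" for m
      using g unfolding fst_conv snd_conv by (intro has_sum_cmult_right has_sum_infsum)
    show "(\<lambda>m::int. exp (- a * (of_int m)\<^sup>2) * infsum (\<lambda>n::int. exp (- a * (of_int n)\<^sup>2)) UNIV) summable_on UNIV"
      using g by (rule summable_on_cmult_left)
  qed auto
  hence "(\<lambda>p::int \<times> int. exp (b\<^sup>2 / (2 * c)) * (exp (- a * (of_int (fst p))\<^sup>2) * exp (- a * (of_int (snd p))\<^sup>2))) summable_on UNIV"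
    unfolding UNIV_Times_UNIV by (rule summable_on_cmult_right)
  thus ?thesis
  proof (rule summable_on_comparison_test)
    fix p :: "int \<times> int"
    define t where "t = norm (lattice_pt \<tau> p)"
    have "b * t - c * t\<^sup>2 = b\<^sup>2 / (2 * c) - c / 2 * t\<^sup>2 - c / 2 * (t - b / c)\<^sup>2"
      using c by (simp add: power2_eq_square field_simps)
    also have "\<dots> \<le> b\<^sup>2 / (2 * c) - c / 2 * t\<^sup>2" using c by simp
    also have "c / 2 * (\<kappa> * ((of_int (fst p))\<^sup>2 + (of_int (snd p))\<^sup>2)) \<le> c / 2 * t\<^sup>2"
      unfolding t_def using c \<kappa>(2)[of p] by (intro mult_left_mono) auto
    hence "b\<^sup>2 / (2 * c) - c / 2 * t\<^sup>2 \<le> b\<^sup>2 / (2 * c) + (- a * (of_int (fst p))\<^sup>2 + - a * (of_int (snd p))\<^sup>2)"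
      by (simp add: a_def algebra_simps)
    finally have "exp (b * t - c * t\<^sup>2) \<le> exp (b\<^sup>2 / (2 * c) + (- a * (of_int (fst p))\<^sup>2 + - a * (of_int (snd p))\<^sup>2))"
      by simp
    thus "exp (b * norm (lattice_pt \<tau> p) - c * (norm (lattice_pt \<tau> p))\<^sup>2) \<le> exp (b\<^sup>2 / (2 * c)) * (exp (- a * (of_int (fst p))\<^sup>2) * exp (- a * (of_int (snd p))\<^sup>2))"
      unfolding exp_add t_def .
  qed auto
qed

text \<open>Only finitely many lattice points lie within distance 1 of - u, so the least distance is
  attained. This is the uniform control of the poles that the majorants require.\<close>

lemma lattice_dist_pos:
  assumes "Im \<tau> > 0" and u: "\<And>p. u + lattice_pt \<tau> p \<noteq> 0"
  obtains \<delta> where "\<delta> > 0" "\<And>p. \<delta> \<le> norm (u + lattice_pt \<tau> p)"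
proof -
  obtain \<kappa> where \<kappa>: "\<kappa> > 0" "\<And>p. \<kappa> * ((of_int (fst p))\<^sup>2 + (of_int (snd p))\<^sup>2) \<le> (norm (lattice_pt \<tau> p))\<^sup>2"
    using lattice_pt_norm_ge[OF assms(1)] by blast
  define N where "N = \<lceil>(norm u + 1)\<^sup>2 / \<kappa>\<rceil>"
  have sq: "\<bar>k\<bar> \<le> k\<^sup>2" for k :: int
    using self_le_power[of "\<bar>k\<bar>" 2] by (cases "k = 0") auto
  have fin: "finite {p. norm (u + lattice_pt \<tau> p) < 1}"
  proof (rule finite_subset)
    show "{p. norm (u + lattice_pt \<tau> p) < 1} \<subseteq> {- N..N} \<times> {- N..N}"
    proof
      fix p assume "p \<in> {p. norm (u + lattice_pt \<tau> p) < 1}"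
      hence "norm (lattice_pt \<tau> p) \<le> norm u + 1"
        using norm_triangle_ineq4[of "u + lattice_pt \<tau> p" u] by simp
      hence "(norm (lattice_pt \<tau> p))\<^sup>2 \<le> (norm u + 1)\<^sup>2" by (intro power_mono) auto
      with \<kappa>(2)[of p] have "\<kappa> * ((of_int (fst p))\<^sup>2 + (of_int (snd p))\<^sup>2) \<le> (norm u + 1)\<^sup>2"
        by (rule order_trans)
      hence "(of_int (fst p))\<^sup>2 + (of_int (snd p))\<^sup>2 \<le> (norm u + 1)\<^sup>2 / \<kappa>"
        using \<kappa>(1) by (simp only: pos_le_divide_eq mult.commute)
      also have "\<dots> \<le> of_int N" by (simp add: N_def)
      finally have "(fst p)\<^sup>2 + (snd p)\<^sup>2 \<le> N"
        by (simp only: of_int_power[symmetric] of_int_add[symmetric] of_int_le_iff)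
      hence "\<bar>fst p\<bar> \<le> N" "\<bar>snd p\<bar> \<le> N"
        using sq[of "fst p"] sq[of "snd p"] by linarith+
      thus "p \<in> {- N..N} \<times> {- N..N}" by (cases p) auto
    qed
  qed auto
  define \<delta> where "\<delta> = Min (insert 1 ((\<lambda>p. norm (u + lattice_pt \<tau> p)) ` {p. norm (u + lattice_pt \<tau> p) < 1}))"
  have "\<delta> > 0" unfolding \<delta>_def using fin u by (subst Min_gr_iff) auto
  moreover have "\<delta> \<le> norm (u + lattice_pt \<tau> p)" for p
  proof (cases "norm (u + lattice_pt \<tau> p) < 1")
    case True
    thus ?thesis unfolding \<delta>_def using fin by (intro Min_le) auto
  next
    case False
    moreover have "\<delta> \<le> 1" unfolding \<delta>_def using fin by (intro Min_le) auto
    ultimately show ?thesis by linarith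
  qed
  ultimately show ?thesis using that by blast
qed

text \<open>
  The parameter \<open>v\<close> takes the place of \<open>cnj u\<close>: as a function of independent \<open>u\<close> and \<open>v\<close> the sum is
  holomorphic, so its derivatives can be taken termwise.
\<close>

definition appell_sum_term :: "nat \<Rightarrow> complex \<Rightarrow> complex \<Rightarrow> complex \<Rightarrow> int \<times> int \<Rightarrow> complex" where
  "appell_sum_term l \<tau> u v p = (-1) powi (int l * (fst p * snd p + fst p + snd p))
     * exp (- of_real (pi * of_nat l / Im \<tau>) * (v * lattice_pt \<tau> p + lattice_pt \<tau> p * cnj (lattice_pt \<tau> p) / 2))
     / (u + lattice_pt \<tau> p)"

text \<open>The bound depends on v only through \<open>b\<close> and on u only through
  \<open>\<delta>\<close>, so it serves as a majorant on a whole neighbourhood.\<close>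

lemma norm_appell_sum_term_le:
  assumes "Im \<tau> > 0" "\<delta> > 0" "\<delta> \<le> norm (u + lattice_pt \<tau> p)" "norm v \<le> b"
  shows "norm (appell_sum_term l \<tau> u v p) \<le> 1 / \<delta> *
     exp (pi * of_nat l / Im \<tau> * b * norm (lattice_pt \<tau> p) - pi * of_nat l / Im \<tau> / 2 * (norm (lattice_pt \<tau> p))\<^sup>2)"
proof -
  define c where "c = pi * of_nat l / Im \<tau>"
  define L where "L = lattice_pt \<tau> p"
  have c: "c \<ge> 0" using assms(1) by (simp add: c_def)
  have "- Re (v * L) \<le> norm (v * L)" using abs_Re_le_cmod[of "v * L"] by linarith
  also have "\<dots> \<le> b * norm L" unfolding norm_mult using assms(4) by (intro mult_right_mono) auto
  finally have "c * (- Re (v * L)) \<le> c * (b * norm L)" using c by (rule mult_left_mono)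
  moreover have "Re (- of_real c * (v * L + L * cnj L / 2)) = c * (- Re (v * L)) - c / 2 * (norm L)\<^sup>2"
    unfolding complex_norm_square[symmetric] by (simp add: algebra_simps)
  ultimately have "Re (- of_real c * (v * L + L * cnj L / 2)) \<le> c * b * norm L - c / 2 * (norm L)\<^sup>2"
    by simp
  hence "exp (Re (- of_real c * (v * L + L * cnj L / 2))) / norm (u + L) \<le> exp (c * b * norm L - c / 2 * (norm L)\<^sup>2) / \<delta>"
    using assms unfolding L_def by (intro frac_le) auto
  thus ?thesis
    unfolding appell_sum_term_def norm_mult norm_divide norm_power_int norm_exp_eq_Re c_def L_def
    by (simp add: mult_ac)
qed

lemma appell_sum_term_summable:
  assumes "Im \<tau> > 0" "l > 0" "\<And>p. u + lattice_pt \<tau> p \<noteq> 0"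
  shows "appell_sum_term l \<tau> u v summable_on UNIV"
proof -
  obtain \<delta> where \<delta>: "\<delta> > 0" "\<And>p. \<delta> \<le> norm (u + lattice_pt \<tau> p)"
    using lattice_dist_pos[OF assms(1,3)] by blast
  have "(\<lambda>p. 1 / \<delta> * exp (pi * of_nat l / Im \<tau> * norm v * norm (lattice_pt \<tau> p) - pi * of_nat l / Im \<tau> / 2 * (norm (lattice_pt \<tau> p))\<^sup>2)) summable_on UNIV"
    using assms by (intro summable_on_cmult_right lattice_exp_summable) auto
  hence "(\<lambda>p. norm (appell_sum_term l \<tau> u v p)) summable_on UNIV"
    by (rule Infinite_Sum.abs_summable_on_comparison_test') (intro norm_appell_sum_term_le assms \<delta> order.refl)
  thus ?thesis by (rule abs_summable_summable)
qed

text \<open>L - cnj L = 2 i m Im \<tau> depends on m alone. Expanding the kernel exponent at u + L,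
  the terms u (L - cnj L) and L (L - cnj L) / 2, multiplied by c, become 2 pi i l m u and pi i l
  (m^2 \<tau> + m n); the last part is the sign that accounts for \<open>m n\<close> in the exponent
  of -1.\<close>

lemma appell_sum_term_eq_kernel:
  fixes l :: nat and u \<tau> :: complex and m n :: int
  assumes "Im \<tau> > 0"
  defines "c \<equiv> pi * of_nat l / Im \<tau>"
  shows "exp (of_real c * (u\<^sup>2 / 2 - u * cnj u)) * appell_sum_term l \<tau> u (cnj u) (m, n) =
    (-1) powi (int l * m) * exp (- (2 * of_real pi * \<i> * of_nat l * of_int m * u) - of_real pi * \<i> * of_nat l * (of_int m)\<^sup>2 * \<tau>)
     * ((-1) powi (int l * n) * appell_kernel c (u + of_int m * \<tau> + of_int n))"
proof -
  define L where "L = of_int m * \<tau> + of_int n"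
  define a b x y where "a = Re u" and "b = Im u" and "x = Re \<tau>" and "y = Im \<tau>"
  have y: "y > 0" using assms by (simp add: y_def)
  have "of_real c * (u\<^sup>2 / 2 - u * cnj u) + \<i> * of_real pi * of_int (int l * (m * n)) + - of_real c * (cnj u * L + L * cnj L / 2) =
     - (2 * of_real pi * \<i> * of_nat l * of_int m * u) - of_real pi * \<i> * of_nat l * (of_int m)\<^sup>2 * \<tau> + of_real c * ((u + L)\<^sup>2 / 2 - (u + L) * cnj (u + L))"
    unfolding complex_eq_iff using y
    by (simp add: L_def c_def power2_eq_square flip: a_def b_def x_def y_def) (simp add: field_simps)
  hence "exp (of_real c * (u\<^sup>2 / 2 - u * cnj u)) * (-1) powi (int l * (m * n)) * exp (- of_real c * (cnj u * L + L * cnj L / 2)) =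
     exp (- (2 * of_real pi * \<i> * of_nat l * of_int m * u) - of_real pi * \<i> * of_nat l * (of_int m)\<^sup>2 * \<tau>) * exp (of_real c * ((u + L)\<^sup>2 / 2 - (u + L) * cnj (u + L)))"
    unfolding neg_one_powi_eq_exp exp_add[symmetric] by (simp only:)
  moreover have "(-1 :: complex) powi (int l * (m * n + m + n)) = (-1) powi (int l * m) * (-1) powi (int l * n) * (-1) powi (int l * (m * n))"
    unfolding distrib_left by (simp add: power_int_add)
  ultimately show ?thesis
    unfolding appell_sum_term_def appell_kernel_def lattice_pt_def fst_conv snd_conv c_def[symmetric] L_def
    by (simp add: mult_ac add.assoc)
qed

text \<open>
  With \<open>n\<close> and \<open>n'\<close> the summation indices of \<open>\<theta>\<close> and \<open>R\<close>, the substitution is \<open>m = n + n' + 1\<close>,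
  \<open>k = l (n + 1) + j\<close>, so that \<open>j\<close> is the residue of \<open>k\<close> modulo \<open>l\<close>.
\<close>

lemma theta_R_double_sum:
  fixes l :: nat and u \<tau> :: complex
  assumes \<tau>: "Im \<tau> > 0" and l: "l > 0"
  shows "((\<lambda>(m, k). (-1) powi (int l * m) * exp (- (2 * of_real pi * \<i> * of_nat l * of_int m * u) - of_real pi * \<i> * of_nat l * (of_int m)\<^sup>2 * \<tau>) *
     (exp (2 * of_real pi * \<i> * (of_int k - of_nat l / 2) * (u + of_int m * \<tau>)) *
      of_real ((if k < int l * (m + 1) then 1 else - 1) - zwegers_E (erf_arg l (Im \<tau>) (Im (u + of_int m * \<tau>)) k))))
    has_sum (\<i> * (\<Sum>j = 0..<l. exp (2 * of_real pi * \<i> * of_nat j * u)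
        * zwegers_theta (of_nat j * \<tau> + (of_nat l - 1) / 2) (of_nat l * \<tau>)
        * zwegers_R (of_nat l * u - of_nat j * \<tau> - (of_nat l - 1) / 2) (of_nat l * \<tau>)))) UNIV"
    (is "(?B has_sum _) _")
proof -
  define \<Theta> where "\<Theta> = (\<lambda>j (n::int). let \<nu> = of_int n + 1/2 in
        exp (of_real pi * \<i> * \<nu>\<^sup>2 * (of_nat l * \<tau>) + 2 * of_real pi * \<i> * \<nu> * (of_nat j * \<tau> + (of_nat l - 1) / 2 + 1/2)))"
  define U where "U = (\<lambda>j. of_nat l * u - of_nat j * \<tau> - (of_nat l - 1) / 2)"
  define \<rho> where "\<rho> = (\<lambda>j (n::int). let \<nu> = (of_int n + 1/2 :: real) in
        of_real (sgn \<nu> - zwegers_E ((\<nu> + Im (U j) / Im (of_nat l * \<tau>)) * sqrt (2 * Im (of_nat l * \<tau>))))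
        * (-1) powi n * q_pow (- (\<nu>\<^sup>2 / 2)) (of_nat l * \<tau>) * exp (- (2 * of_real pi * \<i> * of_real \<nu> * U j)) :: complex)"
  have l\<tau>: "Im (of_nat l * \<tau>) > 0" using \<tau> l by simp
  have prod: "((\<lambda>(n, n'). \<Theta> j n * \<rho> j n') has_sum
      (zwegers_theta (of_nat j * \<tau> + (of_nat l - 1) / 2) (of_nat l * \<tau>) * zwegers_R (U j) (of_nat l * \<tau>))) (UNIV \<times> UNIV)" for j
    unfolding zwegers_theta_def zwegers_R_def \<Theta>_def \<rho>_def
    by (intro has_sum_product zwegers_theta_terms_summable zwegers_R_terms_summable l\<tau>)
  define T where "T = (\<lambda>(j::nat, n::int, n'::int). \<i> * exp (2 * of_real pi * \<i> * of_nat j * u) * (\<Theta> j n * \<rho> j n'))"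
  have T1: "((\<lambda>q. T (j, q)) has_sum \<i> * (exp (2 * of_real pi * \<i> * of_nat j * u)
        * zwegers_theta (of_nat j * \<tau> + (of_nat l - 1) / 2) (of_nat l * \<tau>)
        * zwegers_R (of_nat l * u - of_nat j * \<tau> - (of_nat l - 1) / 2) (of_nat l * \<tau>))) UNIV" for j
    using has_sum_cmult_right[OF prod[of j], of "\<i> * exp (2 * of_real pi * \<i> * of_nat j * u)"]
    by (simp add: T_def U_def case_prod_unfold mult.assoc)
  have "(T has_sum (\<Sum>j = 0..<l. \<i> * (exp (2 * of_real pi * \<i> * of_nat j * u)
        * zwegers_theta (of_nat j * \<tau> + (of_nat l - 1) / 2) (of_nat l * \<tau>)
        * zwegers_R (of_nat l * u - of_nat j * \<tau> - (of_nat l - 1) / 2) (of_nat l * \<tau>)))) (\<Union>j\<in>{0..<l}. Pair j ` UNIV)"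
  proof (rule sum_has_sum)
    show "(T has_sum \<i> * (exp (2 * of_real pi * \<i> * of_nat j * u)
        * zwegers_theta (of_nat j * \<tau> + (of_nat l - 1) / 2) (of_nat l * \<tau>)
        * zwegers_R (of_nat l * u - of_nat j * \<tau> - (of_nat l - 1) / 2) (of_nat l * \<tau>))) (Pair j ` UNIV)" for j
      using T1[of j] by (subst has_sum_reindex) (auto simp: inj_on_def o_def)
  qed auto
  also have "(\<Union>j\<in>{0..<l}. Pair j ` (UNIV :: (int \<times> int) set)) = {0..<l} \<times> UNIV" by auto
  finally have T: "(T has_sum (\<i> * (\<Sum>j = 0..<l. exp (2 * of_real pi * \<i> * of_nat j * u)
        * zwegers_theta (of_nat j * \<tau> + (of_nat l - 1) / 2) (of_nat l * \<tau>)
        * zwegers_R (of_nat l * u - of_nat j * \<tau> - (of_nat l - 1) / 2) (of_nat l * \<tau>)))) ({0..<l} \<times> UNIV)"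
    by (simp add: sum_distrib_left)
  have T_B: "T (j, n, n') = ?B (n + n' + 1, int l * (n + 1) + int j)" if "j < l" for j n n'
  proof -
    define \<mu> \<nu> :: complex where "\<mu> = of_int n + 1/2" and "\<nu> = of_int n' + 1/2"
    define \<nu>r where "\<nu>r = real_of_int n' + 1/2"
    define m k where "m = n + n' + 1" and "k = int l * (n + 1) + int j"
    have "sgn \<nu>r = (if n' \<ge> 0 then 1 else - 1)"
    proof (cases "n' \<ge> 0")
      case False
      hence "real_of_int n' \<le> - 1" by linarith
      thus ?thesis using False by (simp add: \<nu>r_def)
    qed (simp add: \<nu>r_def)
    \<comment> \<open>l (m + 1) - k = l (n' + 1) - j with 0 \<le> j < l, so the sign of \<nu> = n' +
      1/2 can be read off from m and k without reference to j.\<close>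
    moreover have "k < int l * (m + 1) \<longleftrightarrow> n' \<ge> 0"
    proof -
      have "int l * (m + 1) - k = int l * (n' + 1) - int j" by (simp add: m_def k_def algebra_simps)
      moreover have "int j < int l * (n' + 1)" if "n' \<ge> 0"
      proof -
        have "int l * 1 \<le> int l * (n' + 1)" using that by (intro mult_left_mono) auto
        thus ?thesis using \<open>j < l\<close> by linarith
      qed
      moreover have "int l * (n' + 1) \<le> 0" if "\<not> n' \<ge> 0"
        using that by (intro mult_nonneg_nonpos) auto
      ultimately show ?thesis by force
    qed
    ultimately have sgn: "sgn \<nu>r = (if k < int l * (m + 1) then 1 else - 1)" by simp
    have arg: "(\<nu>r + Im (U j) / Im (of_nat l * \<tau>)) * sqrt (2 * Im (of_nat l * \<tau>)) = erf_arg l (Im \<tau>) (Im (u + of_int m * \<tau>)) k"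
    proof -
      have "\<nu>r + Im (U j) / Im (of_nat l * \<tau>) = Im (u + of_int m * \<tau>) / Im \<tau> - (of_int k - of_nat l / 2) / of_nat l"
        using \<tau> l by (simp add: \<nu>r_def U_def m_def k_def field_simps)
      thus ?thesis by (simp add: erf_arg_def mult.assoc)
    qed
    have \<nu>r: "complex_of_real \<nu>r = \<nu>" by (simp add: \<nu>r_def \<nu>_def)
    \<comment> \<open>With the factor i written as exp (i pi / 2), comparing the two terms becomes a
      single polynomial identity between exponents.\<close>
    have "\<i> * of_real (pi / 2) + 2 * of_real pi * \<i> * of_nat j * u + (of_real pi * \<i> * \<mu>\<^sup>2 * (of_nat l * \<tau>) + 2 * of_real pi * \<i> * \<mu> * (of_nat j * \<tau> + (of_nat l - 1) / 2 + 1/2))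
       + \<i> * of_real pi * of_int n' + 2 * of_real pi * \<i> * of_real (- (\<nu>r\<^sup>2 / 2)) * (of_nat l * \<tau>) + - (2 * of_real pi * \<i> * of_real \<nu>r * U j)
     = \<i> * of_real pi * of_int (int l * m) + (- (2 * of_real pi * \<i> * of_nat l * of_int m * u) - of_real pi * \<i> * of_nat l * (of_int m)\<^sup>2 * \<tau>) + 2 * of_real pi * \<i> * (of_int k - of_nat l / 2) * (u + of_int m * \<tau>)"
      unfolding of_real_minus of_real_divide of_real_power \<nu>r U_def \<mu>_def \<nu>_def m_def k_def
      by (simp add: power2_eq_square field_simps)
    hence "exp (\<i> * of_real (pi / 2)) * exp (2 * of_real pi * \<i> * of_nat j * u) * exp (of_real pi * \<i> * \<mu>\<^sup>2 * (of_nat l * \<tau>) + 2 * of_real pi * \<i> * \<mu> * (of_nat j * \<tau> + (of_nat l - 1) / 2 + 1/2))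
       * (-1) powi n' * q_pow (- (\<nu>r\<^sup>2 / 2)) (of_nat l * \<tau>) * exp (- (2 * of_real pi * \<i> * of_real \<nu>r * U j))
     = (-1) powi (int l * m) * exp (- (2 * of_real pi * \<i> * of_nat l * of_int m * u) - of_real pi * \<i> * of_nat l * (of_int m)\<^sup>2 * \<tau>) * exp (2 * of_real pi * \<i> * (of_int k - of_nat l / 2) * (u + of_int m * \<tau>))"
      unfolding neg_one_powi_eq_exp q_pow_def exp_add[symmetric] by (simp only:)
    moreover have "exp (\<i> * of_real (pi / 2)) = \<i>"
      by (simp only: cis_conv_exp[symmetric] cis_pi_half)
    ultimately have E: "\<i> * exp (2 * of_real pi * \<i> * of_nat j * u) * exp (of_real pi * \<i> * \<mu>\<^sup>2 * (of_nat l * \<tau>) + 2 * of_real pi * \<i> * \<mu> * (of_nat j * \<tau> + (of_nat l - 1) / 2 + 1/2))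
       * (-1) powi n' * q_pow (- (\<nu>r\<^sup>2 / 2)) (of_nat l * \<tau>) * exp (- (2 * of_real pi * \<i> * of_real \<nu>r * U j))
     = (-1) powi (int l * m) * exp (- (2 * of_real pi * \<i> * of_nat l * of_int m * u) - of_real pi * \<i> * of_nat l * (of_int m)\<^sup>2 * \<tau>) * exp (2 * of_real pi * \<i> * (of_int k - of_nat l / 2) * (u + of_int m * \<tau>))"
      by (simp only:)
    have "T (j, n, n') = \<i> * exp (2 * of_real pi * \<i> * of_nat j * u) * (exp (of_real pi * \<i> * \<mu>\<^sup>2 * (of_nat l * \<tau>) + 2 * of_real pi * \<i> * \<mu> * (of_nat j * \<tau> + (of_nat l - 1) / 2 + 1/2)) *
       (of_real (sgn \<nu>r - zwegers_E (erf_arg l (Im \<tau>) (Im (u + of_int m * \<tau>)) k)) * (-1) powi n' * q_pow (- (\<nu>r\<^sup>2 / 2)) (of_nat l * \<tau>) * exp (- (2 * of_real pi * \<i> * of_real \<nu>r * U j))))"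
      unfolding T_def \<Theta>_def \<rho>_def Let_def prod.case arg[symmetric] \<mu>_def \<nu>r_def ..
    also have "\<dots> = (\<i> * exp (2 * of_real pi * \<i> * of_nat j * u) * exp (of_real pi * \<i> * \<mu>\<^sup>2 * (of_nat l * \<tau>) + 2 * of_real pi * \<i> * \<mu> * (of_nat j * \<tau> + (of_nat l - 1) / 2 + 1/2))
       * (-1) powi n' * q_pow (- (\<nu>r\<^sup>2 / 2)) (of_nat l * \<tau>) * exp (- (2 * of_real pi * \<i> * of_real \<nu>r * U j))) * of_real (sgn \<nu>r - zwegers_E (erf_arg l (Im \<tau>) (Im (u + of_int m * \<tau>)) k))"
      by (simp only: mult_ac)
    also have "\<dots> = ?B (m, k)"
      unfolding E sgn prod.case by (simp only: mult_ac)
    finally show ?thesis unfolding m_def k_def .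
  qed
  have "(T has_sum S) ({0..<l} \<times> UNIV) = (?B has_sum S) UNIV" for S
  proof (rule has_sum_reindex_bij_witness[of _ "\<lambda>(m, k). (nat (k mod int l), k div int l - 1, m - k div int l)" "\<lambda>(j, n, n'). (n + n' + 1, int l * (n + 1) + int j)"])
    fix a :: "nat \<times> int \<times> int" assume a: "a \<in> {0..<l} \<times> UNIV"
    obtain j n n' where a_eq: "a = (j, n, n')" by (metis prod_cases3)
    have j: "j < l" using a by (simp add: a_eq)
    have d: "(int l * (n + 1) + int j) div int l = n + 1" "(int l * (n + 1) + int j) mod int l = int j"
      using j l by auto
    show "(case case a of (j, n, n') \<Rightarrow> (n + n' + 1, int l * (n + 1) + int j) of (m, k) \<Rightarrow> (nat (k mod int l), k div int l - 1, m - k div int l)) = a"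
      unfolding a_eq prod.case d by simp
    show "?B (case a of (j, n, n') \<Rightarrow> (n + n' + 1, int l * (n + 1) + int j)) = T a"
      using T_B[OF j, of n n'] unfolding a_eq prod.case by (rule sym)
  qed (use l in \<open>auto simp: nat_less_iff\<close>)
  with T show ?thesis by blast
qed

section \<open>The completed Appell function as a lattice sum\<close>

text \<open>
  Replacing \<open>E\<close> by a sign function minus a rapidly decaying difference and summing by parts makes the
  factor \<open>1 - exp (2 * pi * \<i> * w)\<close> cancel, except in the one term where the sign jumps.
\<close>

lemma appell_kernel_sum_split:
  fixes l :: nat and y :: real and w :: complex and K :: int
  assumes l: "l > 0" and y: "y > 0" and w: "\<And>n::int. w + of_int n \<noteq> 0"
  defines "z \<equiv> (\<lambda>k::int. exp (2 * of_real pi * \<i> * (of_int k - of_nat l / 2) * w) *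
      of_real ((if k < K then 1 else - 1) - zwegers_E (erf_arg l y (Im w) k)))"
  assumes z: "z summable_on UNIV"
  shows "(\<Sum>\<^sub>\<infinity>n::int. (-1) powi (int l * n) * appell_kernel (pi * of_nat l / y) (w + of_int n)) =
    - (of_real pi * \<i>) * (2 * exp (2 * of_real pi * \<i> * (of_int K - of_nat l / 2) * w) / (1 - exp (2 * of_real pi * \<i> * w)) + infsum z UNIV)"
proof -
  define h where "h = (\<lambda>k::int. exp (2 * of_real pi * \<i> * (of_int k - of_nat l / 2) * w))"
  define e where "e = exp (2 * of_real pi * \<i> * w)"
  define S where "S = (\<lambda>k::int. if k < K then 1 else - 1 :: real)"
  define E where "E = (\<lambda>k. zwegers_E (erf_arg l y (Im w) k))"
  have h_shift: "h k = e * h (k - 1)" for k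
    unfolding h_def e_def exp_add[symmetric] by (rule arg_cong[of _ _ exp]) (simp add: algebra_simps)
  have "e \<noteq> 1"
  proof
    assume "e = 1"
    then obtain n where "2 * pi * Im w = 0" "2 * pi * Re w = of_int (2 * n) * pi"
      unfolding e_def exp_eq_1 by auto
    hence "w + of_int (- n) = 0" by (simp add: complex_eq_iff)
    thus False using w by blast
  qed
  have z_eq: "z = (\<lambda>k. h k * of_real (S k - E k))"
    by (simp add: z_def h_def S_def E_def fun_eq_iff)
  have "(z has_sum infsum z UNIV) UNIV" using z by simp
  moreover have "((\<lambda>k. z (k - 1)) has_sum infsum z UNIV) UNIV"
    using z by (subst has_sum_reindex_bij_witness[of _ "\<lambda>k. k + 1" "\<lambda>k. k - 1" UNIV z]) auto
  \<comment> \<open>The sign changes only between K - 1 and K. This gives the one term that is not a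
    multiple of 1 - e and keeps a pole after the division.\<close>
  moreover have "((\<lambda>k. h k * of_real (S (k - 1) - S k)) has_sum 2 * h K) UNIV"
    by (rule has_sum_finite_neutralI[of "{K}"]) (auto simp: S_def)
  ultimately have "((\<lambda>k. h k * of_real (S (k - 1) - S k) - e * z (k - 1) + z k) has_sum (2 * h K - e * infsum z UNIV + infsum z UNIV)) UNIV"
    unfolding diff_conv_add_uminus
    by (intro has_sum_add has_sum_cmult_right has_sum_uminusI)
  moreover have "h k * of_real (S (k - 1) - S k) - e * z (k - 1) + z k = h k * of_real (E (k - 1) - E k)" for k
    unfolding z_eq mult.assoc[symmetric] h_shift[symmetric] by (simp add: algebra_simps)
  ultimately have "(\<Sum>\<^sub>\<infinity>k. h k * of_real (E (k - 1) - E k)) = 2 * h K - e * infsum z UNIV + infsum z UNIV"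
    by (simp add: infsumI)
  moreover have "(1 - e) * (\<Sum>\<^sub>\<infinity>n::int. (-1) powi (int l * n) * appell_kernel (pi * of_nat l / y) (w + of_int n)) =
     - (of_real pi * \<i>) * (\<Sum>\<^sub>\<infinity>k. h k * of_real (E (k - 1) - E k))"
    unfolding e_def h_def E_def by (rule appell_kernel_sum[OF l y w])
  moreover have "2 * h K - e * infsum z UNIV + infsum z UNIV = 2 * h K + (1 - e) * infsum z UNIV"
    by (simp add: algebra_simps)
  ultimately have "(1 - e) * (\<Sum>\<^sub>\<infinity>n::int. (-1) powi (int l * n) * appell_kernel (pi * of_nat l / y) (w + of_int n)) =
     - (of_real pi * \<i>) * (2 * h K + (1 - e) * infsum z UNIV)"
    by (simp only:)
  hence "(\<Sum>\<^sub>\<infinity>n::int. (-1) powi (int l * n) * appell_kernel (pi * of_nat l / y) (w + of_int n)) =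
     - (of_real pi * \<i>) * (2 * h K + (1 - e) * infsum z UNIV) / (1 - e)"
    using \<open>e \<noteq> 1\<close> by (intro eq_divide_imp) (auto intro: trans[OF mult.commute])
  also have "\<dots> = - (of_real pi * \<i>) * (2 * h K / (1 - e) + infsum z UNIV)"
    using \<open>e \<noteq> 1\<close> by (simp add: field_simps)
  finally show ?thesis unfolding h_def e_def .
qed

text \<open>Summed over the rows, the jump terms of \<open>appell_kernel_sum_split\<close> form the
  Appell sum and the remaining sums form the products of \<theta> and R. The double series of the
  latter is summed row by row, and its convergence also supplies the summability that the splitting
  of each row demands.\<close>

theorem appell_hat_eq_lattice_sum:
  assumes \<tau>: "Im \<tau> > 0" and l: "l > 0" and u: "\<And>p. u + lattice_pt \<tau> p \<noteq> 0"
  shows "appell_hat l u \<tau> = \<i> / (2 * of_real pi) * exp (of_real (pi * of_nat l / Im \<tau>) * (u\<^sup>2 / 2 - u * cnj u)) *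
     (\<Sum>\<^sub>\<infinity>p. appell_sum_term l \<tau> u (cnj u) p)"
proof -
  define c where "c = pi * of_nat l / Im \<tau>"
  define G where "G = exp (of_real c * (u\<^sup>2 / 2 - u * cnj u))"
  define a where "a = (\<lambda>m::int. (-1) powi (int l * m) * exp (- (2 * of_real pi * \<i> * of_nat l * of_int m * u) - of_real pi * \<i> * of_nat l * (of_int m)\<^sup>2 * \<tau>))"
  define w where "w = (\<lambda>m::int. u + of_int m * \<tau>)"
  define P where "P = (\<lambda>m. \<Sum>\<^sub>\<infinity>n::int. (-1) powi (int l * n) * appell_kernel c (w m + of_int n))"
  \<comment> \<open>With this threshold the sign in \<open>z\<close> is that of \<nu> in R, and the
    jump term times \<open>a m\<close> has exactly the exponent pi i l u + pi i l m (m + 1) \<tau>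
    of the Appell sum.\<close>
  define K where "K = (\<lambda>m. int l * (m + 1))"
  define z where "z = (\<lambda>m (k::int). exp (2 * of_real pi * \<i> * (of_int k - of_nat l / 2) * w m) *
      of_real ((if k < K m then 1 else - 1) - zwegers_E (erf_arg l (Im \<tau>) (Im (w m)) k)))"
  define J where "J = (\<Sum>j = 0..<l. exp (2 * of_real pi * \<i> * of_nat j * u)
        * zwegers_theta (of_nat j * \<tau> + (of_nat l - 1) / 2) (of_nat l * \<tau>)
        * zwegers_R (of_nat l * u - of_nat j * \<tau> - (of_nat l - 1) / 2) (of_nat l * \<tau>))"
  define t where "t = (\<lambda>n::int. exp (of_real pi * \<i> * of_nat l * u) * ((-1) powi (int l * n) * q_pow (real l * of_int n * (of_int n + 1) / 2) \<tau>
                 / (1 - exp (2 * of_real pi * \<i> * u) * q_pow (of_int n) \<tau>)))"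
  have a_nz: "a m \<noteq> 0" for m by (simp add: a_def)
  have w_nz: "w m + of_int n \<noteq> 0" for m n
    using u[of "(m, n)"] by (simp add: w_def lattice_pt_def add.assoc)

  have X: "((\<lambda>p. G * appell_sum_term l \<tau> u (cnj u) p) has_sum G * (\<Sum>\<^sub>\<infinity>p. appell_sum_term l \<tau> u (cnj u) p)) (UNIV \<times> UNIV)"
    using appell_sum_term_summable[OF \<tau> l u] by (intro has_sum_cmult_right) simp
  have X_in: "G * appell_sum_term l \<tau> u (cnj u) (m, n) = a m * ((-1) powi (int l * n) * appell_kernel c (w m + of_int n))" for m n
    unfolding G_def c_def a_def w_def by (rule appell_sum_term_eq_kernel[OF \<tau>])
  have X_sum: "((\<lambda>m. a m * P m) has_sum G * (\<Sum>\<^sub>\<infinity>p. appell_sum_term l \<tau> u (cnj u) p)) UNIV"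
  proof (rule has_sum_SigmaD[OF X])
    fix m :: int
    have "(\<lambda>(m, n). G * appell_sum_term l \<tau> u (cnj u) (m, n)) summable_on UNIV \<times> UNIV"
      using X by (auto simp: summable_on_def case_prod_unfold)
    hence "(\<lambda>n. G * appell_sum_term l \<tau> u (cnj u) (m, n)) summable_on UNIV"
      by (rule summable_on_SigmaD1) simp
    moreover have "(\<Sum>\<^sub>\<infinity>n. G * appell_sum_term l \<tau> u (cnj u) (m, n)) = a m * P m"
      unfolding X_in P_def infsum_cmult_right' ..
    ultimately show "((\<lambda>n. G * appell_sum_term l \<tau> u (cnj u) (m, n)) has_sum a m * P m) UNIV"
      by (simp only: has_sum_iff)
  qed

  have B: "((\<lambda>(m, k). a m * z m k) has_sum \<i> * J) (UNIV \<times> UNIV)"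
    using theta_R_double_sum[OF \<tau> l, of u] unfolding a_def z_def w_def K_def J_def UNIV_Times_UNIV .
  have z_summable: "z m summable_on UNIV" for m
  proof -
    have "(\<lambda>k. a m * z m k) summable_on UNIV"
      using has_sum_imp_summable[OF B] by (rule summable_on_SigmaD1) simp
    thus ?thesis using summable_on_cmult_right'[OF a_nz] by blast
  qed
  have B_sum: "((\<lambda>m. a m * infsum (z m) UNIV) has_sum \<i> * J) UNIV"
    by (rule has_sum_SigmaD[OF B]) (use z_summable in \<open>auto intro!: has_sum_cmult_right\<close>)

  have P_eq: "P m = - (of_real pi * \<i>) * (2 * exp (2 * of_real pi * \<i> * (of_int (K m) - of_nat l / 2) * w m) / (1 - exp (2 * of_real pi * \<i> * w m)) + infsum (z m) UNIV)" for m
    unfolding P_def c_def z_def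
    by (rule appell_kernel_sum_split[OF l \<tau> w_nz]) (use z_summable[of m] in \<open>simp add: z_def\<close>)
  have t_eq: "t m = \<i> / (2 * of_real pi) * (a m * P m) - 1 / 2 * (a m * infsum (z m) UNIV)" for m
  proof -
    have "- (2 * of_real pi * \<i> * of_nat l * of_int m * u) - of_real pi * \<i> * of_nat l * (of_int m)\<^sup>2 * \<tau> + 2 * of_real pi * \<i> * (of_int (K m) - of_nat l / 2) * w m
       = of_real pi * \<i> * of_nat l * u + 2 * of_real pi * \<i> * of_real (real l * of_int m * (of_int m + 1) / 2) * \<tau>"
      by (simp add: K_def w_def power2_eq_square field_simps)
    hence 1: "exp (- (2 * of_real pi * \<i> * of_nat l * of_int m * u) - of_real pi * \<i> * of_nat l * (of_int m)\<^sup>2 * \<tau>) * exp (2 * of_real pi * \<i> * (of_int (K m) - of_nat l / 2) * w m) =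
        exp (of_real pi * \<i> * of_nat l * u) * q_pow (real l * of_int m * (of_int m + 1) / 2) \<tau>"
      unfolding q_pow_def exp_add[symmetric] by (simp only:)
    have 2: "exp (2 * of_real pi * \<i> * w m) = exp (2 * of_real pi * \<i> * u) * q_pow (of_int m) \<tau>"
      unfolding q_pow_def exp_add[symmetric] by (rule arg_cong[of _ _ exp]) (simp add: w_def algebra_simps)
    have "\<i> / (2 * of_real pi) * (a m * P m) = a m * (exp (2 * of_real pi * \<i> * (of_int (K m) - of_nat l / 2) * w m) / (1 - exp (2 * of_real pi * \<i> * w m)) + 1 / 2 * infsum (z m) UNIV)"
      unfolding P_eq by (simp add: field_simps)
    also have "a m * exp (2 * of_real pi * \<i> * (of_int (K m) - of_nat l / 2) * w m) = exp (of_real pi * \<i> * of_nat l * u) * ((-1) powi (int l * m) * q_pow (real l * of_int m * (of_int m + 1) / 2) \<tau>)"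
      unfolding a_def mult.assoc[of "(-1) powi (int l * m)"] 1 by (simp only: mult_ac)
    hence "a m * (exp (2 * of_real pi * \<i> * (of_int (K m) - of_nat l / 2) * w m) / (1 - exp (2 * of_real pi * \<i> * w m)) + 1 / 2 * infsum (z m) UNIV) = t m + 1 / 2 * (a m * infsum (z m) UNIV)"
      unfolding t_def 2[symmetric] by (simp add: distrib_left)
    finally show ?thesis by simp
  qed
  have "((\<lambda>m. \<i> / (2 * of_real pi) * (a m * P m) + - (1 / 2 * (a m * infsum (z m) UNIV))) has_sum
      (\<i> / (2 * of_real pi) * (G * (\<Sum>\<^sub>\<infinity>p. appell_sum_term l \<tau> u (cnj u) p)) + - (1 / 2 * (\<i> * J)))) UNIV"
    by (intro has_sum_add has_sum_uminusI has_sum_cmult_right X_sum B_sum)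
  also have "(\<lambda>m. \<i> / (2 * of_real pi) * (a m * P m) + - (1 / 2 * (a m * infsum (z m) UNIV))) = t"
    unfolding t_eq[abs_def] by simp
  finally have "infsum t UNIV = \<i> / (2 * of_real pi) * (G * (\<Sum>\<^sub>\<infinity>p. appell_sum_term l \<tau> u (cnj u) p)) - 1 / 2 * (\<i> * J)"
    by (simp add: infsumI)
  moreover have "appell l u \<tau> = infsum t UNIV"
    unfolding appell_def t_def infsum_cmult_right' ..
  ultimately show ?thesis
    unfolding appell_hat_def J_def[symmetric] G_def c_def by (simp add: mult.assoc)
qed

section \<open>The Wirtinger derivative\<close>

text \<open>Along the line (\<alpha> t, \<beta> t) the sum is holomorphic in the single complex
  variable t, so the theorem on uniform limits of holomorphic functions applies. The choices (1, 0)
  and (0, 1) separate the two partial derivatives; \<beta> = cnj \<alpha> with t real is the motion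
  of u in direction \<alpha>.\<close>

lemma appell_sum_has_field_derivative:
  assumes \<tau>: "Im \<tau> > 0" and l: "l > 0" and u: "\<And>p. u + lattice_pt \<tau> p \<noteq> 0"
    and \<alpha>: "norm \<alpha> \<le> 1" and \<beta>: "norm \<beta> \<le> 1"
  obtains g' where
    "((\<lambda>t. \<Sum>\<^sub>\<infinity>p. appell_sum_term l \<tau> (u + \<alpha> * t) (v + \<beta> * t) p) has_field_derivative g') (at 0)"
    "((\<lambda>p. \<alpha> * (- appell_sum_term l \<tau> u v p / (u + lattice_pt \<tau> p)) +
        \<beta> * (- of_real (pi * of_nat l / Im \<tau>) * lattice_pt \<tau> p * appell_sum_term l \<tau> u v p)) has_sum g') UNIV"
proof -
  obtain \<delta> where \<delta>: "\<delta> > 0" "\<And>p. \<delta> \<le> norm (u + lattice_pt \<tau> p)"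
    using lattice_dist_pos[OF \<tau> u] by blast
  \<comment> \<open>Half the distance keeps every moved pole at least \<delta> / 2 away; the cap 1
    bounds the moved v by norm v + 1.\<close>
  define r where "r = min 1 (\<delta> / 2)"
  define c where "c = pi * of_nat l / Im \<tau>"
  have r: "r > 0" "r \<le> 1" "r \<le> \<delta> / 2" using \<delta> by (auto simp: r_def)
  have dist: "\<delta> / 2 \<le> norm (u + \<alpha> * t + lattice_pt \<tau> p)" if "norm t \<le> r" for t p
  proof -
    have "norm (\<alpha> * t) \<le> 1 * (\<delta> / 2)"
      unfolding norm_mult using \<alpha> that r by (intro mult_mono) auto
    moreover have "norm (u + lattice_pt \<tau> p) \<le> norm (u + \<alpha> * t + lattice_pt \<tau> p) + norm (\<alpha> * t)"
      using norm_triangle_ineq4[of "u + \<alpha> * t + lattice_pt \<tau> p" "\<alpha> * t"] by (simp add: algebra_simps)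
    ultimately show ?thesis using \<delta>(2)[of p] by linarith
  qed
  have v_bound: "norm (v + \<beta> * t) \<le> norm v + 1" if "norm t \<le> r" for t
  proof -
    have "norm (\<beta> * t) \<le> 1 * 1"
      unfolding norm_mult using \<beta> that r by (intro mult_mono) auto
    thus ?thesis using norm_triangle_ineq[of v "\<beta> * t"] by linarith
  qed
  define T where "T = (\<lambda>p t. appell_sum_term l \<tau> (u + \<alpha> * t) (v + \<beta> * t) p)"
  define T' where "T' = (\<lambda>p t. \<alpha> * (- T p t / (u + \<alpha> * t + lattice_pt \<tau> p)) + \<beta> * (- of_real c * lattice_pt \<tau> p * T p t))"
  define M where "M = (\<lambda>p. 1 / (\<delta> / 2) *
     exp (pi * of_nat l / Im \<tau> * (norm v + 1) * norm (lattice_pt \<tau> p) - pi * of_nat l / Im \<tau> / 2 * (norm (lattice_pt \<tau> p))\<^sup>2))"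
  have M: "M summable_on UNIV"
    unfolding M_def using \<tau> l by (intro summable_on_cmult_right lattice_exp_summable) auto
  have ul: "uniform_limit (cball 0 r) (\<lambda>X t. \<Sum>p\<in>X. T p t) (\<lambda>t. \<Sum>\<^sub>\<infinity>p. T p t) (finite_subsets_at_top UNIV)"
  proof (rule Weierstrass_m_test_general[OF _ M])
    show "norm (T p t) \<le> M p" if "t \<in> cball 0 r" for p t
      unfolding T_def M_def using that \<delta> by (intro norm_appell_sum_term_le dist v_bound \<tau>) auto
  qed
  have deriv: "(T p has_field_derivative T' p t) (at t)" if "norm t \<le> r" for p t
  proof -
    have nz: "u + \<alpha> * t + lattice_pt \<tau> p \<noteq> 0" using dist[OF that, of p] \<delta> by auto
    define s :: complex where "s = (-1) powi (int l * (fst p * snd p + fst p + snd p))"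
    define L where "L = lattice_pt \<tau> p"
    have T_eq: "T p = (\<lambda>t. s * exp (- of_real c * ((v + \<beta> * t) * L + L * cnj L / 2)) / (u + \<alpha> * t + L))"
      by (simp add: T_def appell_sum_term_def fun_eq_iff s_def c_def L_def)
    have nz': "u + \<alpha> * t + L \<noteq> 0" using nz by (simp add: L_def)
    have "((\<lambda>t. s * exp (- of_real c * ((v + \<beta> * t) * L + L * cnj L / 2))) has_field_derivative
       s * (exp (- of_real c * ((v + \<beta> * t) * L + L * cnj L / 2)) * (- of_real c * (\<beta> * L)))) (at t)"
      by (auto intro!: derivative_eq_intros)
    moreover have "((\<lambda>t. u + \<alpha> * t + L) has_field_derivative \<alpha>) (at t)"
      by (auto intro!: derivative_eq_intros)
    ultimately have "(T p has_field_derivative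
       (s * (exp (- of_real c * ((v + \<beta> * t) * L + L * cnj L / 2)) * (- of_real c * (\<beta> * L))) * (u + \<alpha> * t + L) -
        s * exp (- of_real c * ((v + \<beta> * t) * L + L * cnj L / 2)) * \<alpha>) / ((u + \<alpha> * t + L) * (u + \<alpha> * t + L))) (at t)"
      unfolding T_eq using nz' by (rule DERIV_divide)
    also have "(s * (exp (- of_real c * ((v + \<beta> * t) * L + L * cnj L / 2)) * (- of_real c * (\<beta> * L))) * (u + \<alpha> * t + L) -
        s * exp (- of_real c * ((v + \<beta> * t) * L + L * cnj L / 2)) * \<alpha>) / ((u + \<alpha> * t + L) * (u + \<alpha> * t + L)) = T' p t"
    proof -
      have *: "(s * (e * (- C * (\<beta> * L))) * w - s * e * \<alpha>) / (w * w) = \<alpha> * (- (s * e / w) / w) + \<beta> * (- C * L * (s * e / w))"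
        if "w \<noteq> 0" for e w C :: complex
        using that by (simp add: divide_simps)
      show ?thesis unfolding T'_def T_eq L_def[symmetric] by (rule *[OF nz'])
    qed
    finally show ?thesis .
  qed
  obtain g' where g': "\<And>w. w \<in> ball 0 r \<Longrightarrow> ((\<lambda>t. \<Sum>\<^sub>\<infinity>p. T p t) has_field_derivative g' w) (at w) \<and>
      ((\<lambda>X. \<Sum>p\<in>X. T' p w) \<longlongrightarrow> g' w) (finite_subsets_at_top UNIV)"
  proof (rule has_complex_derivative_uniform_limit[OF _ ul _ r(1)])
    have "continuous_on (cball 0 r) (T p)" for p
      by (rule DERIV_continuous_on[OF has_field_derivative_at_within[OF deriv]]) auto
    hence "continuous_on (cball 0 r) (\<lambda>t. \<Sum>p\<in>X. T p t)" for X
      by (intro continuous_on_sum)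
    moreover have "((\<lambda>t. \<Sum>p\<in>X. T p t) has_field_derivative (\<Sum>p\<in>X. T' p w)) (at w)" if "w \<in> ball 0 r" for X w
      using that by (intro DERIV_sum deriv) auto
    ultimately show "\<forall>\<^sub>F X in finite_subsets_at_top UNIV. continuous_on (cball 0 r) (\<lambda>t. \<Sum>p\<in>X. T p t) \<and>
      (\<forall>w\<in>ball 0 r. ((\<lambda>t. \<Sum>p\<in>X. T p t) has_field_derivative (\<Sum>p\<in>X. T' p w)) (at w))"
      by (intro always_eventually) auto
  qed (auto intro: that)
  show ?thesis
  proof (rule that)
    show "((\<lambda>t. \<Sum>\<^sub>\<infinity>p. appell_sum_term l \<tau> (u + \<alpha> * t) (v + \<beta> * t) p) has_field_derivative g' 0) (at 0)"
      using g'[of 0] r unfolding T_def by auto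
    show "((\<lambda>p. \<alpha> * (- appell_sum_term l \<tau> u v p / (u + lattice_pt \<tau> p)) +
        \<beta> * (- of_real (pi * of_nat l / Im \<tau>) * lattice_pt \<tau> p * appell_sum_term l \<tau> u v p)) has_sum g' 0) UNIV"
      using g'[of 0] r unfolding has_sum_def T'_def T_def c_def by simp
  qed
qed

text \<open>The Wirtinger derivative treats cnj u as a constant: the Gaussian prefactor contributes
  c (u - cnj u), and each simple pole becomes a double one. The derivatives in v, collected in
  \<open>B\<close>, cancel between the directions 1 and i.\<close>

theorem d_appell_hat_eq_lattice_sum:
  assumes \<tau>: "Im \<tau> > 0" and l: "l > 0" and u: "\<And>p. u + lattice_pt \<tau> p \<noteq> 0"
  defines "c \<equiv> pi * of_nat l / Im \<tau>"
  shows "d_appell_hat l u \<tau> = \<i> / (2 * of_real pi) * exp (of_real c * (u\<^sup>2 / 2 - u * cnj u)) *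
     (of_real c * (u - cnj u) * (\<Sum>\<^sub>\<infinity>p. appell_sum_term l \<tau> u (cnj u) p)
      - (\<Sum>\<^sub>\<infinity>p. appell_sum_term l \<tau> u (cnj u) p / (u + lattice_pt \<tau> p)))"
proof -
  define v where "v = cnj u"
  define S where "S = (\<Sum>\<^sub>\<infinity>p. appell_sum_term l \<tau> u v p)"
  define A where "A = (\<lambda>p. - appell_sum_term l \<tau> u v p / (u + lattice_pt \<tau> p))"
  define B where "B = (\<lambda>p. - of_real (pi * of_nat l / Im \<tau>) * lattice_pt \<tau> p * appell_sum_term l \<tau> u v p)"
  have A: "A summable_on UNIV"
    using appell_sum_has_field_derivative[OF \<tau> l u, of 1 0 v] unfolding A_def B_def
    by (auto simp: summable_on_def)
  have B: "B summable_on UNIV"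
    using appell_sum_has_field_derivative[OF \<tau> l u, of 0 1 v] unfolding A_def B_def
    by (auto simp: summable_on_def)
  have S_deriv: "((\<lambda>t. \<Sum>\<^sub>\<infinity>p. appell_sum_term l \<tau> (u + \<alpha> * t) (v + \<beta> * t) p) has_field_derivative \<alpha> * infsum A UNIV + \<beta> * infsum B UNIV) (at 0)"
    if ab: "norm \<alpha> \<le> 1" "norm \<beta> \<le> 1" for \<alpha> \<beta>
  proof -
    obtain g' where g': "((\<lambda>t. \<Sum>\<^sub>\<infinity>p. appell_sum_term l \<tau> (u + \<alpha> * t) (v + \<beta> * t) p) has_field_derivative g') (at 0)"
      "((\<lambda>p. \<alpha> * A p + \<beta> * B p) has_sum g') UNIV"
      unfolding A_def B_def using appell_sum_has_field_derivative[OF \<tau> l u ab, of v] by blast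
    moreover have "((\<lambda>p. \<alpha> * A p + \<beta> * B p) has_sum (\<alpha> * infsum A UNIV + \<beta> * infsum B UNIV)) UNIV"
      using A B by (intro has_sum_add has_sum_cmult_right) auto
    ultimately show ?thesis using has_sum_unique by blast
  qed
  obtain \<delta> where \<delta>: "\<delta> > 0" "\<And>p. \<delta> \<le> norm (u + lattice_pt \<tau> p)"
    using lattice_dist_pos[OF \<tau> u] by blast
  define F where "F = exp (of_real c * (u\<^sup>2 / 2 - u * v))"
  have vd: "vector_derivative (\<lambda>t::real. appell_hat l (u + \<alpha> * of_real t) \<tau>) (at 0) =
     \<i> / (2 * of_real pi) * F * (of_real c * (\<alpha> * u - \<alpha> * v - u * cnj \<alpha>) * S + (\<alpha> * infsum A UNIV + cnj \<alpha> * infsum B UNIV))"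
    if \<alpha>: "norm \<alpha> = 1" for \<alpha>
  proof -
    define H where "H = (\<lambda>t. \<i> / (2 * of_real pi) * exp (of_real c * ((u + \<alpha> * t)\<^sup>2 / 2 - (u + \<alpha> * t) * (v + cnj \<alpha> * t))) *
       (\<Sum>\<^sub>\<infinity>p. appell_sum_term l \<tau> (u + \<alpha> * t) (v + cnj \<alpha> * t) p))"
    \<comment> \<open>Moved by less than \<delta>, the point stays off the poles, so the
      real-variable derivative of the completion is that of the holomorphic
      \<open>H\<close>.\<close>
    have eq: "H (of_real t) = appell_hat l (u + \<alpha> * of_real t) \<tau>" if "dist t 0 < \<delta>" for t
    proof -
      have "u + \<alpha> * of_real t + lattice_pt \<tau> p \<noteq> 0" for p
      proof
        assume "u + \<alpha> * of_real t + lattice_pt \<tau> p = 0"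
        hence "u + lattice_pt \<tau> p = - (\<alpha> * of_real t)" by (simp add: eq_neg_iff_add_eq_0 add_ac)
        hence "norm (u + lattice_pt \<tau> p) = \<bar>t\<bar>" using \<alpha> by (simp add: norm_mult)
        thus False using \<delta>(2)[of p] that by simp
      qed
      from appell_hat_eq_lattice_sum[OF \<tau> l this] show ?thesis
        by (simp add: H_def v_def c_def)
    qed
    have "((\<lambda>t. exp (of_real c * ((u + \<alpha> * t)\<^sup>2 / 2 - (u + \<alpha> * t) * (v + cnj \<alpha> * t)))) has_field_derivative
        F * (of_real c * (\<alpha> * u - \<alpha> * v - u * cnj \<alpha>))) (at 0)"
      unfolding F_def by (auto intro!: derivative_eq_intros simp: algebra_simps)
    from DERIV_cmult[OF DERIV_mult'[OF this S_deriv[of \<alpha> "cnj \<alpha>"]], of "\<i> / (2 * of_real pi)"]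
    have "(H has_field_derivative \<i> / (2 * of_real pi) * (F * (\<alpha> * infsum A UNIV + cnj \<alpha> * infsum B UNIV) + F * (of_real c * (\<alpha> * u - \<alpha> * v - u * cnj \<alpha>)) * S)) (at 0)"
      using \<alpha> by (simp add: H_def S_def F_def mult.assoc)
    also have "\<i> / (2 * of_real pi) * (F * (\<alpha> * infsum A UNIV + cnj \<alpha> * infsum B UNIV) + F * (of_real c * (\<alpha> * u - \<alpha> * v - u * cnj \<alpha>)) * S) =
      \<i> / (2 * of_real pi) * F * (of_real c * (\<alpha> * u - \<alpha> * v - u * cnj \<alpha>) * S + (\<alpha> * infsum A UNIV + cnj \<alpha> * infsum B UNIV))"
      by (simp only: distrib_left mult.assoc add.commute)
    finally have "(H has_field_derivative \<i> / (2 * of_real pi) * F * (of_real c * (\<alpha> * u - \<alpha> * v - u * cnj \<alpha>) * S + (\<alpha> * infsum A UNIV + cnj \<alpha> * infsum B UNIV))) (at (of_real 0))"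
      by simp
    from has_vector_derivative_real_field[OF this]
    have "((\<lambda>t::real. appell_hat l (u + \<alpha> * of_real t) \<tau>) has_vector_derivative \<i> / (2 * of_real pi) * F * (of_real c * (\<alpha> * u - \<alpha> * v - u * cnj \<alpha>) * S + (\<alpha> * infsum A UNIV + cnj \<alpha> * infsum B UNIV))) (at 0)"
      by (rule has_vector_derivative_transform_within[OF _ \<delta>(1)]) (use eq in auto)
    thus ?thesis by (rule vector_derivative_at)
  qed
  have A_eq: "infsum A UNIV = - (\<Sum>\<^sub>\<infinity>p. appell_sum_term l \<tau> u v p / (u + lattice_pt \<tau> p))"
    unfolding A_def by (simp add: infsum_uminus)
  define K a b where "K = \<i> / (2 * of_real pi) * F" and "a = infsum A UNIV" and "b = infsum B UNIV"
  have "vector_derivative (\<lambda>t::real. appell_hat l (u + of_real t) \<tau>) (at 0) = K * (a + b - of_real c * v * S)"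
    using vd[of 1] by (simp add: K_def a_def b_def)
  moreover have "vector_derivative (\<lambda>t::real. appell_hat l (u + \<i> * of_real t) \<tau>) (at 0) = \<i> * (K * (of_real c * (2 * u - v) * S + (a - b)))"
    unfolding vd[OF norm_ii] K_def[symmetric] a_def[symmetric] b_def[symmetric] by (simp add: algebra_simps)
  ultimately have "d_appell_hat l u \<tau> = K * (of_real c * (u - v) * S + a)"
    unfolding d_appell_hat_def wirtinger_def by simp (simp add: algebra_simps)
  hence "d_appell_hat l u \<tau> = \<i> / (2 * of_real pi) * F * (of_real c * (u - v) * S + infsum A UNIV)"
    unfolding K_def a_def .
  thus ?thesis unfolding A_eq S_def v_def F_def by simp
qed

section \<open>Modular transformations\<close>

text \<open>A weight-two Eisenstein series over the shifted lattice, with w = (m + x) \<tau> + n,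
  twisted by a phase and damped by |w|^2 / Im \<tau>. This quotient is unchanged when SL2 acts on
  \<tau> and on the lattice basis together, so only the phase and w^2 transform.\<close>

definition g_series :: "nat \<Rightarrow> real \<Rightarrow> complex \<Rightarrow> complex" where
  "g_series l x \<tau> = (\<Sum>\<^sub>\<infinity>(m, n). exp (\<i> * of_real pi * of_real (real l * (of_int (m * n + m + n) + of_int n * x))
      - of_real (pi * of_nat l / (2 * Im \<tau>)) * of_real ((norm ((of_int m + of_real x) * \<tau> + of_int n))\<^sup>2))
     / ((of_int m + of_real x) * \<tau> + of_int n)\<^sup>2)"

lemma real_mult_plus_lattice_pt_nonzero:
  assumes "Im \<tau> > 0" "x \<notin> \<int>"
  shows "of_real x * \<tau> + lattice_pt \<tau> p \<noteq> 0"
proof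
  assume "of_real x * \<tau> + lattice_pt \<tau> p = 0"
  hence "Im (of_real x * \<tau> + lattice_pt \<tau> p) = 0" by simp
  hence "(x + of_int (fst p)) * Im \<tau> = 0" by (simp add: lattice_pt_def algebra_simps)
  hence "x = of_int (- fst p)" using assms(1) by simp
  thus False using assms(2) Ints_of_int by blast
qed

lemma real_plus_lattice_pt_nonzero:
  assumes "Im \<tau> > 0" "x \<notin> \<int>"
  shows "of_real x + lattice_pt \<tau> p \<noteq> 0"
proof
  assume *: "of_real x + lattice_pt \<tau> p = 0"
  hence "Im (of_real x + lattice_pt \<tau> p) = 0" by simp
  hence "fst p = 0" using assms(1) by (simp add: lattice_pt_def)
  hence "x + of_int (snd p) = 0" using * by (simp add: lattice_pt_def complex_eq_iff)
  hence "x = of_int (- snd p)" by simp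
  thus False using assms(2) Ints_of_int by blast
qed

text \<open>At u = x \<tau> the factor c (u - cnj u) equals 2 pi i l x. The term subtracted in the
  definition of g therefore removes the series with simple poles, and the power of q completes the
  exponent to a Gaussian in |u + \<lambda>|^2, up to the phase exp (pi i l n x).\<close>

lemma g_fun_eq_g_series:
  assumes \<tau>: "Im \<tau> > 0" and l: "l > 0" and x: "x \<notin> \<int>"
  shows "g_fun l x \<tau> = - (\<i> / (2 * of_real pi)) * g_series l x \<tau>"
proof -
  define u where "u = of_real x * \<tau>"
  define c where "c = pi * of_nat l / Im \<tau>"
  define F where "F = exp (of_real c * (u\<^sup>2 / 2 - u * cnj u))"
  define S where "S = (\<Sum>\<^sub>\<infinity>p. appell_sum_term l \<tau> u (cnj u) p)"
  define S2 where "S2 = (\<Sum>\<^sub>\<infinity>p. appell_sum_term l \<tau> u (cnj u) p / (u + lattice_pt \<tau> p))"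
  have nz: "u + lattice_pt \<tau> p \<noteq> 0" for p
    unfolding u_def by (rule real_mult_plus_lattice_pt_nonzero[OF \<tau> x])
  have cu: "of_real c * (u - cnj u) = 2 * of_real pi * \<i> * of_nat l * of_real x"
    using \<tau> by (simp add: complex_eq_iff c_def u_def)
  have app: "appell_hat l u \<tau> = \<i> / (2 * of_real pi) * F * S"
    unfolding F_def S_def c_def by (rule appell_hat_eq_lattice_sum[OF \<tau> l nz])
  have d_app: "d_appell_hat l u \<tau> = \<i> / (2 * of_real pi) * F * (2 * of_real pi * \<i> * of_nat l * of_real x * S - S2)"
    unfolding cu[symmetric] unfolding F_def S_def S2_def c_def by (rule d_appell_hat_eq_lattice_sum[OF \<tau> l nz])
  have "Q * (D * F * (Y * S - S2) - Y * (D * F * S)) = - D * (Q * F * S2)" for Q D Y :: complex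
    by (simp add: algebra_simps)
  hence "g_fun l x \<tau> = - (\<i> / (2 * of_real pi)) * (q_pow (- (real l / 2 * x\<^sup>2)) \<tau> * F * S2)"
    unfolding g_fun_def u_def[symmetric] app d_app .
  moreover have "q_pow (- (real l / 2 * x\<^sup>2)) \<tau> * F * S2 = g_series l x \<tau>"
    unfolding S2_def g_series_def infsum_cmult_right'[symmetric]
  proof (rule infsum_cong)
    fix p :: "int \<times> int"
    obtain m n where p: "p = (m, n)" by fastforce
    define L where "L = lattice_pt \<tau> (m, n)"
    have uL: "u + L = (of_int m + of_real x) * \<tau> + of_int n"
      by (simp add: u_def L_def lattice_pt_def algebra_simps)
    define y t where "y = Im \<tau>" and "t = Re \<tau>"
    have y: "y > 0" using \<tau> by (simp add: y_def)
    have "2 * of_real pi * \<i> * of_real (- (real l / 2 * x\<^sup>2)) * \<tau> + of_real c * (u\<^sup>2 / 2 - u * cnj u) + (\<i> * of_real pi * of_int (int l * (m * n + m + n))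
         + - of_real c * (cnj u * L + L * cnj L / 2)) =
       \<i> * of_real pi * of_real (real l * (of_int (m * n + m + n) + of_int n * x)) - of_real (pi * of_nat l / (2 * Im \<tau>)) * of_real ((norm (u + L))\<^sup>2)"
      unfolding complex_eq_iff cmod_power2 using y
      by (simp add: u_def L_def lattice_pt_def c_def power2_eq_square flip: y_def t_def) (simp add: field_simps)
    hence "q_pow (- (real l / 2 * x\<^sup>2)) \<tau> * F * ((-1) powi (int l * (m * n + m + n)) * exp (- of_real c * (cnj u * L + L * cnj L / 2))) =
       exp (\<i> * of_real pi * of_real (real l * (of_int (m * n + m + n) + of_int n * x)) - of_real (pi * of_nat l / (2 * Im \<tau>)) * of_real ((norm (u + L))\<^sup>2))"
      unfolding q_pow_def F_def neg_one_powi_eq_exp exp_add[symmetric] by (simp only:)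
    thus "q_pow (- (real l / 2 * x\<^sup>2)) \<tau> * F * (appell_sum_term l \<tau> u (cnj u) p / (u + lattice_pt \<tau> p)) =
      (case p of (m, n) \<Rightarrow> exp (\<i> * of_real pi * of_real (real l * (of_int (m * n + m + n) + of_int n * x))
      - of_real (pi * of_nat l / (2 * Im \<tau>)) * of_real ((norm ((of_int m + of_real x) * \<tau> + of_int n))\<^sup>2))
     / ((of_int m + of_real x) * \<tau> + of_int n)\<^sup>2)"
      unfolding p prod.case uL[symmetric] appell_sum_term_def fst_conv snd_conv c_def[symmetric] L_def[symmetric]
      by (simp only: times_divide_eq_right divide_divide_eq_left power2_eq_square)
  qed
  ultimately show ?thesis by simp
qed

text \<open>The point u = - x is real, so u - cnj u = 0 and again only double poles remain. The
  lattice of \<sigma> = - 1 / \<tau> is that of \<tau> divided by \<tau>; since u + \<lambda> = - W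
  / \<tau>, the slash factor \<tau>^(-2) turns the double pole into 1 / W^2.\<close>

lemma slash2_d_appell_hat_eq_g_series:
  assumes \<tau>: "Im \<tau> > 0" and l: "l > 0" and x: "x \<notin> \<int>"
  shows "slash2 (\<lambda>\<sigma>. d_appell_hat l (- of_real x) \<sigma>) (mat2 0 (-1) 1 0) \<tau> = - (\<i> / (2 * of_real pi)) * g_series l x \<tau>"
proof -
  define \<sigma> where "\<sigma> = - 1 / \<tau>"
  define c where "c = pi * of_nat l / Im \<sigma>"
  define u :: complex where "u = of_real (- x)"
  have \<tau>0: "\<tau> \<noteq> 0" using \<tau> by auto
  have \<sigma>: "Im \<sigma> = Im \<tau> / (norm \<tau>)\<^sup>2"
    by (simp add: \<sigma>_def Im_divide cmod_power2)
  have \<sigma>_pos: "Im \<sigma> > 0" unfolding \<sigma> using \<tau> \<tau>0 by simp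
  have x': "- x \<notin> \<int>" using x by (simp add: minus_in_Ints_iff)
  have nz: "u + lattice_pt \<sigma> p \<noteq> 0" for p
    unfolding u_def by (rule real_plus_lattice_pt_nonzero[OF \<sigma>_pos x'])
  have "cnj u = u" by (simp add: u_def)
  hence d: "d_appell_hat l u \<sigma> = - (\<i> / (2 * of_real pi)) * (exp (of_real c * (- (u\<^sup>2 / 2))) * (\<Sum>\<^sub>\<infinity>p. appell_sum_term l \<sigma> u u p / (u + lattice_pt \<sigma> p)))"
    using d_appell_hat_eq_lattice_sum[OF \<sigma>_pos l nz] unfolding c_def[symmetric] by (simp add: power2_eq_square)
  have series: "\<tau> powi (- 2) * (exp (of_real c * (- (u\<^sup>2 / 2))) * (\<Sum>\<^sub>\<infinity>p. appell_sum_term l \<sigma> u u p / (u + lattice_pt \<sigma> p))) = g_series l x \<tau>"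
    unfolding g_series_def infsum_cmult_right'[symmetric]
  proof (rule infsum_reindex_bij_witness[of _ "\<lambda>(m, n). (n, - m)" "\<lambda>(m, n). (- n, m)"])
    fix p :: "int \<times> int"
    obtain n m where p: "p = (n, - m)" by (metis add.inverse_inverse surj_pair)
    define L where "L = of_int m * \<tau> + of_int n"
    define W where "W = (of_int m + of_real x) * \<tau> + of_int n"
    have lp: "lattice_pt \<sigma> p = - L / \<tau>"
      using \<tau>0 by (simp add: p lattice_pt_def \<sigma>_def L_def field_simps)
    have uW: "u + lattice_pt \<sigma> p = - W / \<tau>"
      unfolding lp using \<tau>0 by (simp add: u_def W_def L_def field_simps)
    have c: "of_real c = of_real (pi * of_nat l / Im \<tau>) * (\<tau> * cnj \<tau>)"
      unfolding c_def \<sigma> complex_norm_square[symmetric] by simp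
    define y t where "y = Im \<tau>" and "t = Re \<tau>"
    have y: "y > 0" using \<tau> by (simp add: y_def)
    \<comment> \<open>The rotated pair is (n, - m); its sign exponent differs from that of (m, n) by
      an even number.\<close>
    have parity: "(-1 :: complex) powi (int l * (n * - m + n + - m)) = exp (\<i> * of_real pi * of_real (real l * of_int (m * n + m + n)))"
    proof -
      have "int l * (n * - m + n + - m) = int l * (m * n + m + n) + 2 * (int l * (- m * n - m))" by (simp add: algebra_simps)
      hence "(-1 :: complex) powi (int l * (n * - m + n + - m)) = (-1) powi (int l * (m * n + m + n))"
        by (simp add: power_int_add power_int_mult)
      thus ?thesis by (simp add: neg_one_powi_eq_exp)
    qed
    have "of_real c * (- (u\<^sup>2 / 2)) + - of_real c * (u * lattice_pt \<sigma> p + lattice_pt \<sigma> p * cnj (lattice_pt \<sigma> p) / 2) =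
       of_real (pi * of_nat l / Im \<tau>) * (- (of_real x * \<tau> * cnj (of_real x * \<tau>)) / 2 - of_real x * cnj \<tau> * L - L * cnj L / 2)"
    proof -
      have "C * (T * T') * (- ((- Y)\<^sup>2 / 2)) + - (C * (T * T')) * (- Y * (- M / T) + (- M / T) * (- M' / T') / 2) =
         C * (- (Y * T * (Y * T')) / 2 - Y * T' * M - M * M' / 2)" if "T \<noteq> 0" "T' \<noteq> 0" for C T T' Y M M' :: complex
        using that by (simp add: divide_simps) (simp add: power2_eq_square algebra_simps)
      from this[of \<tau> "cnj \<tau>" "of_real (pi * of_nat l / Im \<tau>)" "of_real x" L "cnj L"] \<tau>0 show ?thesis
        unfolding c lp u_def by simp
    qed
    also have "\<dots> = \<i> * of_real pi * of_real (real l * (of_int n * x)) - of_real (pi * of_nat l / (2 * Im \<tau>)) * of_real ((norm W)\<^sup>2)"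
      unfolding complex_eq_iff cmod_power2 using y
      by (simp add: W_def L_def power2_eq_square flip: y_def t_def) (simp add: field_simps)
    finally have E: "exp (of_real c * (- (u\<^sup>2 / 2))) * exp (- of_real c * (u * lattice_pt \<sigma> p + lattice_pt \<sigma> p * cnj (lattice_pt \<sigma> p) / 2)) =
       exp (\<i> * of_real pi * of_real (real l * (of_int n * x)) - of_real (pi * of_nat l / (2 * Im \<tau>)) * of_real ((norm W)\<^sup>2))"
      unfolding exp_add[symmetric] by simp
    have "\<tau> powi (- 2) * (exp (of_real c * (- (u\<^sup>2 / 2))) * (appell_sum_term l \<sigma> u u p / (u + lattice_pt \<sigma> p))) =
       exp (\<i> * of_real pi * of_real (real l * of_int (m * n + m + n))) *
       (exp (of_real c * (- (u\<^sup>2 / 2))) * exp (- of_real c * (u * lattice_pt \<sigma> p + lattice_pt \<sigma> p * cnj (lattice_pt \<sigma> p) / 2))) * (\<tau> powi (- 2) / (u + lattice_pt \<sigma> p)\<^sup>2)"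
    proof -
      have "appell_sum_term l \<sigma> u u p = exp (\<i> * of_real pi * of_real (real l * of_int (m * n + m + n))) *
          exp (- of_real c * (u * lattice_pt \<sigma> p + lattice_pt \<sigma> p * cnj (lattice_pt \<sigma> p) / 2)) / (u + lattice_pt \<sigma> p)"
        unfolding appell_sum_term_def c_def[symmetric] parity[symmetric] by (simp only: p fst_conv snd_conv)
      thus ?thesis by (simp add: power2_eq_square)
    qed
    also have "\<tau> powi (- 2) / (u + lattice_pt \<sigma> p)\<^sup>2 = 1 / W\<^sup>2"
      unfolding uW using \<tau>0 by (simp add: power_int_minus power_divide field_simps)
    finally have "\<tau> powi (- 2) * (exp (of_real c * (- (u\<^sup>2 / 2))) * (appell_sum_term l \<sigma> u u p / (u + lattice_pt \<sigma> p))) =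
       exp (\<i> * of_real pi * of_real (real l * (of_int (m * n + m + n) + of_int n * x)) - of_real (pi * of_nat l / (2 * Im \<tau>)) * of_real ((norm W)\<^sup>2)) / W\<^sup>2"
      unfolding E unfolding exp_add[symmetric] by (simp add: algebra_simps)
    thus "(case case p of (m, n) \<Rightarrow> (- n, m) of (m, n) \<Rightarrow> exp (\<i> * of_real pi * of_real (real l * (of_int (m * n + m + n) + of_int n * x))
      - of_real (pi * of_nat l / (2 * Im \<tau>)) * of_real ((norm ((of_int m + of_real x) * \<tau> + of_int n))\<^sup>2))
     / ((of_int m + of_real x) * \<tau> + of_int n)\<^sup>2) =
      \<tau> powi (- 2) * (exp (of_real c * (- (u\<^sup>2 / 2))) * (appell_sum_term l \<sigma> u u p / (u + lattice_pt \<sigma> p)))"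
      by (simp add: p W_def)
  qed auto
  have slash: "slash2 (\<lambda>\<sigma>. d_appell_hat l (- of_real x) \<sigma>) (mat2 0 (-1) 1 0) \<tau> = \<tau> powi (- 2) * d_appell_hat l u \<sigma>"
    by (simp add: slash2_def mat2_def vector_2 u_def \<sigma>_def)
  show ?thesis unfolding slash d series[symmetric] by (simp only: mult_ac)
qed

text \<open>m n + m + n is even exactly when m and n both are, so its parity only tests membership
  in twice the lattice, and determinant 1 preserves that sublattice.\<close>

lemma even_SL2_form:
  fixes a b c d m n :: int
  assumes "a * d - b * c = 1"
  shows "even (((m * a + n * c) * (m * b + n * d) + (m * a + n * c) + (m * b + n * d)) - (m * n + m + n))"
proof -
  have "odd (a * d - b * c)" using assms by simp
  thus ?thesis by (cases "even m"; cases "even n") auto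
qed

text \<open>The row vector (m + x, n) times the matrix is (M + x, N) with M = m a + n c + s and N =
  m b + n d + t; integrality of s = (a - 1) x and t = b x makes this a bijection of integer pairs.
  The point w is divided by j, whence j^2, and the rest is the change of the phase.\<close>

lemma g_series_Gamma1:
  fixes a b c d s t X :: int and x :: real
  assumes \<sigma>: "Im \<sigma> > 0" and det: "a * d - b * c = 1" and s: "of_int s = (of_int a - 1) * x" and t: "of_int t = of_int b * x"
  defines "j \<equiv> of_int c * \<sigma> + of_int d"
  shows "g_series l x ((of_int a * \<sigma> + of_int b) / j) =
    exp (\<i> * of_real pi * of_real (real l * (of_int (s + t) - of_int a * of_int b * x\<^sup>2))) * j\<^sup>2 * g_series l x \<sigma>"
proof -
  define \<sigma>' where "\<sigma>' = (of_int a * \<sigma> + of_int b) / j"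
  have j: "j \<noteq> 0"
  proof
    assume *: "j = 0"
    hence "Im j = 0" by simp
    hence "c = 0" using \<sigma> by (simp add: j_def)
    thus False using * det by (auto simp: j_def)
  qed
  have "Im \<sigma>' = Im ((of_int a * \<sigma> + of_int b) * cnj j) / (norm j)\<^sup>2"
    unfolding \<sigma>'_def by (simp add: Im_divide cmod_power2)
  also have "Im ((of_int a * \<sigma> + of_int b) * cnj j) = of_int (a * d - b * c) * Im \<sigma>"
    by (simp add: j_def algebra_simps)
  finally have Im': "Im \<sigma>' = Im \<sigma> / (norm j)\<^sup>2" by (simp add: det)
  have inj: "a * d = 1 + b * c" using det by simp
  show ?thesis
    unfolding \<sigma>'_def[symmetric] unfolding g_series_def infsum_cmult_right'[symmetric]
  \<comment> \<open>The inverse map subtracts (s, t) and multiplies by the adjugate matrix.\<close>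
  proof (rule infsum_reindex_bij_witness[of _ "\<lambda>(m, n). ((m - s) * d - (n - t) * c, (n - t) * a - (m - s) * b)" "\<lambda>(m, n). (m * a + n * c + s, m * b + n * d + t)"])
    fix p :: "int \<times> int"
    obtain m n where p: "p = (m, n)" by fastforce
    have 1: "(m * a + n * c) * d - (m * b + n * d) * c = m * (a * d - b * c)"
      "(m * b + n * d) * a - (m * a + n * c) * b = n * (a * d - b * c)" by algebra+
    show "(case case p of (m, n) \<Rightarrow> (m * a + n * c + s, m * b + n * d + t) of (m, n) \<Rightarrow> ((m - s) * d - (n - t) * c, (n - t) * a - (m - s) * b)) = p"
      using 1 by (simp add: p det)
    define M N where "M = m * a + n * c + s" and "N = m * b + n * d + t"
    define W where "W = (of_int M + of_real x) * \<sigma> + of_int N"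
    have s': "of_int s = (of_int a - 1) * complex_of_real x"
      using arg_cong[OF s, of complex_of_real] by simp
    have t': "of_int t = of_int b * complex_of_real x"
      using arg_cong[OF t, of complex_of_real] by simp
    have W: "(of_int m + of_real x) * \<sigma>' + of_int n = W / j"
      using j unfolding \<sigma>'_def W_def M_def N_def of_int_add s' t'
      by (simp add: field_simps) (simp add: j_def algebra_simps)
    have nrm: "pi * of_nat l / (2 * Im \<sigma>') * (norm (W / j))\<^sup>2 = pi * of_nat l / (2 * Im \<sigma>) * (norm W)\<^sup>2"
      unfolding Im' norm_divide power_divide using j \<sigma> by (simp add: field_simps)
    obtain e where e: "((m * a + n * c) * (m * b + n * d) + (m * a + n * c) + (m * b + n * d)) - (m * n + m + n) = 2 * e"
      using even_SL2_form[OF det, of m n] by (rule evenE)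
    \<comment> \<open>Half of the change of phase. Here x N + s (m b + n d) - n x supplies a second
      copy of m a t + n c t, through a d = 1 + b c, and s t + x t = a b x^2 cancels the quadratic
      correction.\<close>
    define q where "q = e + s + t + m * a * t + n * c * t"
    have phase: "of_int (s + t) - of_int a * of_int b * x\<^sup>2 + (of_int (M * N + M + N) + of_int N * x) =
      (of_int (m * n + m + n) + of_int n * x) + 2 * of_int q" (is "?L = ?R")
    proof -
      have e': "real_of_int (m * n + m + n) = of_int ((m * a + n * c) * (m * b + n * d) + (m * a + n * c) + (m * b + n * d)) - 2 * of_int e"
        using arg_cong[OF e, of real_of_int] by simp
      have det': "real_of_int a * of_int d = 1 + of_int b * of_int c"
        using arg_cong[OF inj, of real_of_int] by simp
      have "?L - ?R = x * of_int n * (of_int a * of_int d - (1 + of_int b * of_int c))"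
        unfolding e' M_def N_def q_def by (simp add: s t algebra_simps power2_eq_square)
      thus ?thesis by (simp add: det')
    qed
    have "exp (\<i> * of_real pi * of_real (real l * (of_int (s + t) - of_int a * of_int b * x\<^sup>2))) *
        exp (\<i> * of_real pi * of_real (real l * (of_int (M * N + M + N) + of_int N * x)) - of_real (pi * of_nat l / (2 * Im \<sigma>)) * of_real ((norm W)\<^sup>2)) =
       exp (\<i> * of_real pi * of_real (real l * (of_int (m * n + m + n) + of_int n * x)) - of_real (pi * of_nat l / (2 * Im \<sigma>)) * of_real ((norm W)\<^sup>2)) *
       exp ((2 * of_int (int l * q) * of_real pi) * \<i>)"
      unfolding exp_add[symmetric]
    proof (rule arg_cong[of _ _ exp])
      have "\<i> * of_real pi * of_real (real l * (of_int (s + t) - of_int a * of_int b * x\<^sup>2)) + \<i> * of_real pi * of_real (real l * (of_int (M * N + M + N) + of_int N * x)) =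
         \<i> * of_real pi * of_real (real l * ?L)"
        unfolding of_real_mult of_real_add distrib_left ..
      also have "\<dots> = \<i> * of_real pi * of_real (real l * (of_int (m * n + m + n) + of_int n * x)) + (2 * of_int (int l * q) * of_real pi) * \<i>"
        unfolding phase by (simp add: algebra_simps)
      finally show "\<i> * of_real pi * of_real (real l * (of_int (s + t) - of_int a * of_int b * x\<^sup>2)) + (\<i> * of_real pi * of_real (real l * (of_int (M * N + M + N) + of_int N * x)) - of_real (pi * of_nat l / (2 * Im \<sigma>)) * of_real ((norm W)\<^sup>2)) =
        \<i> * of_real pi * of_real (real l * (of_int (m * n + m + n) + of_int n * x)) - of_real (pi * of_nat l / (2 * Im \<sigma>)) * of_real ((norm W)\<^sup>2) + (2 * of_int (int l * q) * of_real pi) * \<i>"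
        by (simp only: add_diff_eq diff_add_eq)
    qed
    moreover have "exp ((2 * of_int (int l * q) * of_real pi) * \<i>) = (1 :: complex)"
      using exp_integer_2pi[of "of_int (int l * q)"] by simp
    ultimately have ph: "exp (\<i> * of_real pi * of_real (real l * (of_int (s + t) - of_int a * of_int b * x\<^sup>2))) *
        exp (\<i> * of_real pi * of_real (real l * (of_int (M * N + M + N) + of_int N * x)) - of_real (pi * of_nat l / (2 * Im \<sigma>)) * of_real ((norm W)\<^sup>2)) =
       exp (\<i> * of_real pi * of_real (real l * (of_int (m * n + m + n) + of_int n * x)) - of_real (pi * of_nat l / (2 * Im \<sigma>)) * of_real ((norm W)\<^sup>2))"
      by (simp only: mult_1_right)
    show "exp (\<i> * of_real pi * of_real (real l * (of_int (s + t) - of_int a * of_int b * x\<^sup>2))) * j\<^sup>2 *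
        (case case p of (m, n) \<Rightarrow> (m * a + n * c + s, m * b + n * d + t) of (m, n) \<Rightarrow> exp (\<i> * of_real pi * of_real (real l * (of_int (m * n + m + n) + of_int n * x))
      - of_real (pi * of_nat l / (2 * Im \<sigma>)) * of_real ((norm ((of_int m + of_real x) * \<sigma> + of_int n))\<^sup>2))
     / ((of_int m + of_real x) * \<sigma> + of_int n)\<^sup>2) =
      (case p of (m, n) \<Rightarrow> exp (\<i> * of_real pi * of_real (real l * (of_int (m * n + m + n) + of_int n * x))
      - of_real (pi * of_nat l / (2 * Im \<sigma>')) * of_real ((norm ((of_int m + of_real x) * \<sigma>' + of_int n))\<^sup>2))
     / ((of_int m + of_real x) * \<sigma>' + of_int n)\<^sup>2)"
      unfolding p prod.case W of_real_mult[symmetric, of "pi * of_nat l / (2 * Im \<sigma>')"] nrm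
      unfolding M_def[symmetric] N_def[symmetric] W_def[symmetric] of_real_mult[of "pi * of_nat l / (2 * Im \<sigma>)"] ph[symmetric]
      by (simp add: power_divide)
  next
    fix p :: "int \<times> int"
    obtain M N where p: "p = (M, N)" by fastforce
    define m n where "m = M - s" and "n = N - t"
    have "(m * d - n * c) * a + (n * a - m * b) * c = m * (a * d - b * c)"
      "(m * d - n * c) * b + (n * a - m * b) * d = n * (a * d - b * c)" by algebra+
    thus "(case case p of (m, n) \<Rightarrow> ((m - s) * d - (n - t) * c, (n - t) * a - (m - s) * b) of (m, n) \<Rightarrow> (m * a + n * c + s, m * b + n * d + t)) = p"
      by (simp add: p det m_def[symmetric] n_def[symmetric]) (simp add: m_def n_def)
  qed auto
qed

(* The exponent of -1 is an integer, because k divides a - 1 and k * x is an integer;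
   the floor only converts its type. *)
theorem proposition2p6:
  fixes l k :: nat and x :: real
  assumes "l > 0"
    and "x \<in> \<rat>" and "x > 0" and "x \<notin> \<int>"
    and "k > 0" and "of_nat k * x \<in> \<int>"
  shows "(\<forall>\<tau>. Im \<tau> > 0 \<longrightarrow>
            g_fun l x \<tau> = slash2 (\<lambda>\<sigma>. d_appell_hat l (- of_real x) \<sigma>) (mat2 0 (-1) 1 0) \<tau>)
       \<and> (\<forall>a b c d \<tau>. mat2 a b c d \<in> Gamma1 k \<longrightarrow> Im \<tau> > 0 \<longrightarrow>
            g_fun l x (of_nat k * ((of_int a * \<tau> + of_int b) / (of_int c * \<tau> + of_int d)))
            = (of_int c * \<tau> + of_int d)\<^sup>2
              * exp (- (of_real pi * \<i> * of_nat l * of_int a * of_int b * of_nat k * (of_real x)\<^sup>2))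
              * (-1) powi \<lfloor>real l * ((of_int a - 1) * x + real k * of_int b * x)\<rfloor>
              * g_fun l x (of_nat k * \<tau>))"
proof (intro conjI allI impI)
  fix \<tau> :: complex assume "Im \<tau> > 0"
  thus "g_fun l x \<tau> = slash2 (\<lambda>\<sigma>. d_appell_hat l (- of_real x) \<sigma>) (mat2 0 (-1) 1 0) \<tau>"
    by (simp only: g_fun_eq_g_series[OF _ assms(1,4)] slash2_d_appell_hat_eq_g_series[OF _ assms(1,4)])
next
  fix a b c d :: int and \<tau> :: complex
  assume \<gamma>: "mat2 a b c d \<in> Gamma1 k" and \<tau>: "Im \<tau> > 0"
  have det: "a * d - b * c = 1" and "[c = 0] (mod int k)" and "[a = 1] (mod int k)"
    using \<gamma> by (auto simp: Gamma1_def mat2_def det_2 vector_2)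
  \<comment> \<open>As k divides c, conjugation by diag (k, 1) gives an integral matrix with rows
    (a, k b) and (c', d), still of determinant 1, which acts on \<sigma> = k \<tau>.
    \<open>g_series_Gamma1\<close> is applied to this matrix.\<close>
  then obtain c' a' where c': "c = int k * c'" and a': "a - 1 = int k * a'"
    by (auto simp: cong_iff_dvd_diff elim!: dvdE)
  obtain X where X: "real k * x = of_int X" using assms(6) by (auto elim: Ints_cases)
  \<comment> \<open>The integers (a - 1) x and k b x for the conjugated matrix: k divides a - 1, and
    k x is the integer \<open>X\<close>.\<close>
  define s t where "s = a' * X" and "t = b * X"
  define \<sigma> where "\<sigma> = of_nat k * \<tau>"
  define j where "j = of_int c * \<tau> + of_int d"
  have s: "of_int s = (of_int a - 1) * x"
    using X arg_cong[OF a', of real_of_int] by (simp add: s_def mult_ac flip: X)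
  have t: "of_int t = of_int (int k * b) * x"
    by (simp add: t_def mult_ac flip: X)
  have \<sigma>: "Im \<sigma> > 0" using \<tau> assms by (simp add: \<sigma>_def)
  have j: "j = of_int c' * \<sigma> + of_int d" by (simp add: j_def \<sigma>_def c')
  have arg: "of_nat k * ((of_int a * \<tau> + of_int b) / (of_int c * \<tau> + of_int d)) = (of_int a * \<sigma> + of_int (int k * b)) / j"
    unfolding j_def[symmetric] by (simp add: \<sigma>_def distrib_left mult_ac)
  have det': "a * d - int k * b * c' = 1" using det by (simp add: c' mult_ac)
  have "Im ((of_int a * \<sigma> + of_int (int k * b)) / j) = Im ((of_int a * \<sigma> + of_int (int k * b)) * cnj j) / (norm j)\<^sup>2"
    by (simp add: Im_divide cmod_power2)
  also have "Im ((of_int a * \<sigma> + of_int (int k * b)) * cnj j) = of_int (a * d - int k * b * c') * Im \<sigma>"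
    unfolding j by (simp add: algebra_simps)
  finally have Im: "Im ((of_int a * \<sigma> + of_int (int k * b)) / j) > 0"
  proof -
    assume *: "Im ((of_int a * \<sigma> + of_int (int k * b)) / j) = of_int (a * d - int k * b * c') * Im \<sigma> / (norm j)\<^sup>2"
    have "j \<noteq> 0"
    proof
      assume "j = 0"
      moreover from this have "Im j = 0" by simp
      hence "c' = 0" using \<sigma> by (simp add: j)
      ultimately show False using det' by (auto simp: j)
    qed
    thus ?thesis unfolding * det' using \<sigma> by simp
  qed
  have fl: "\<lfloor>real l * ((of_int a - 1) * x + real k * of_int b * x)\<rfloor> = int l * (s + t)"
  proof -
    have "real l * ((of_int a - 1) * x + real k * of_int b * x) = of_int (int l * (s + t))"
      using s t by simp
    thus ?thesis by (simp only: floor_of_int)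
  qed
  have "\<i> * of_real pi * of_real (real l * (of_int (s + t) - of_int a * of_int (int k * b) * x\<^sup>2)) =
    - (of_real pi * \<i> * of_nat l * of_int a * of_int b * of_nat k * (of_real x)\<^sup>2) + \<i> * of_real pi * of_int (int l * (s + t))"
    by (simp add: algebra_simps)
  hence ph: "exp (\<i> * of_real pi * of_real (real l * (of_int (s + t) - of_int a * of_int (int k * b) * x\<^sup>2))) =
    exp (- (of_real pi * \<i> * of_nat l * of_int a * of_int b * of_nat k * (of_real x)\<^sup>2)) * (-1) powi (int l * (s + t))"
    unfolding neg_one_powi_eq_exp exp_add[symmetric] by (simp only:)
  show "g_fun l x (of_nat k * ((of_int a * \<tau> + of_int b) / (of_int c * \<tau> + of_int d)))
            = (of_int c * \<tau> + of_int d)\<^sup>2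
              * exp (- (of_real pi * \<i> * of_nat l * of_int a * of_int b * of_nat k * (of_real x)\<^sup>2))
              * (-1) powi \<lfloor>real l * ((of_int a - 1) * x + real k * of_int b * x)\<rfloor>
              * g_fun l x (of_nat k * \<tau>)"
    unfolding arg fl
    unfolding j_def[symmetric] \<sigma>_def[symmetric] g_fun_eq_g_series[OF Im assms(1,4)] g_fun_eq_g_series[OF \<sigma> assms(1,4)]
    unfolding j g_series_Gamma1[OF \<sigma> det' s t] ph by (simp only: mult_ac)
qed

end
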